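(* Let $G$ be a finite 3-group such that $|G:G'| = 9$ and $|G| \ge 81$. Then $G^3 = \gamma_3(G)$, and that subgroup has index 27 in $G$. All maximal subgroups of $G$ can be generated by at most three elements, and either one of the maximal subgroups of $G$ is metacyclic, or $G$ contains a maximal subgroup $H$ such that $|H:H'| \le 27$. If $|G:\gamma_4(G)| = 3^4$, then $G$ is of maximal class.
   Context: $X'$ denotes the commutator subgroup of a group $X$, $G^3$ is the subgroup generated by all cubes of elements of $G$, and $\gamma_i(G)$ is the $i$-th term of the lower central series ($\gamma_1(G)=G$, $\gamma_2(G)=G'$, $\gamma_{i+1}(G)=[\gamma_i(G),G]$). A group of order $p^n \ge p^3$ ($p$ a prime) is said to be of maximal class if its nilpotency class is $n-1$. *)

theory Defs
  imports "HOL-Algebra.Algebra"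
begin

text \<open>
  The commutator convention is the one of the library constant \<^const>\<open>derived\<close>,
  so that the commutator of \<open>H\<close> with itself is literally \<open>derived G H\<close>.
\<close>

definition commutator_subgroup ::
    "('a, 'b) monoid_scheme \<Rightarrow> 'a set \<Rightarrow> 'a set \<Rightarrow> 'a set" where
  "commutator_subgroup G H K =
     generate G (\<Union>h \<in> H. \<Union>k \<in> K. {h \<otimes>\<^bsub>G\<^esub> k \<otimes>\<^bsub>G\<^esub> inv\<^bsub>G\<^esub> h \<otimes>\<^bsub>G\<^esub> inv\<^bsub>G\<^esub> k})"

text \<open>
  The numbering starts at 1: term 1 is the whole group and term 2 the commutator
  subgroup. Term 0 is a junk value (the whole group again).
\<close>

definition lower_central :: "('a, 'b) monoid_scheme \<Rightarrow> nat \<Rightarrow> 'a set" where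
  "lower_central G i =
     ((\<lambda>H. commutator_subgroup G H (carrier G)) ^^ (i - 1)) (carrier G)"

lemma lower_central_1: "lower_central G 1 = carrier G"
  by (simp add: lower_central_def)

lemma lower_central_2: "lower_central G 2 = derived G (carrier G)"
  by (simp add: lower_central_def commutator_subgroup_def derived_def)

lemma lower_central_Suc:
  "1 \<le> i \<Longrightarrow>
    lower_central G (Suc i) = commutator_subgroup G (lower_central G i) (carrier G)"
  by (cases i) (simp_all add: lower_central_def)

definition nilpotent_group :: "('a, 'b) monoid_scheme \<Rightarrow> bool" where
  "nilpotent_group G \<longleftrightarrow> (\<exists>c. lower_central G (c + 1) = {\<one>\<^bsub>G\<^esub>})"

text \<open>Only meaningful for nilpotent groups.\<close>

definition nilpotency_class :: "('a, 'b) monoid_scheme \<Rightarrow> nat" where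
  "nilpotency_class G = (LEAST c. lower_central G (c + 1) = {\<one>\<^bsub>G\<^esub>})"

definition maximal_class :: "('a, 'b) monoid_scheme \<Rightarrow> bool" where
  "maximal_class G \<longleftrightarrow>
     (\<exists>p n. Factorial_Ring.prime (p::nat) \<and> 3 \<le> n \<and> order G = p ^ n \<and>
            nilpotent_group G \<and> nilpotency_class G = n - 1)"

definition power_subgroup :: "('a, 'b) monoid_scheme \<Rightarrow> nat \<Rightarrow> 'a set" where
  "power_subgroup G k = generate G ((\<lambda>x. x [^]\<^bsub>G\<^esub> k) ` carrier G)"

text \<open>
  For a subgroup \<open>K\<close> of a subgroup \<open>H\<close> of \<open>G\<close>, the index of \<open>K\<close> in \<open>H\<close> is
  \<open>subgroup_index (G\<lparr>carrier := H\<rparr>) K\<close>.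
\<close>

definition subgroup_index :: "('a, 'b) monoid_scheme \<Rightarrow> 'a set \<Rightarrow> nat" where
  "subgroup_index G H = card (rcosets\<^bsub>G\<^esub> H)"

definition maximal_subgroup :: "'a set \<Rightarrow> ('a, 'b) monoid_scheme \<Rightarrow> bool" where
  "maximal_subgroup M G \<longleftrightarrow>
     subgroup M G \<and> M \<noteq> carrier G \<and>
     (\<forall>K. subgroup K G \<and> M \<subseteq> K \<longrightarrow> K = M \<or> K = carrier G)"

definition metacyclic_group :: "('a, 'b) monoid_scheme \<Rightarrow> bool" where
  "metacyclic_group G \<longleftrightarrow>
     (\<exists>N. N \<lhd> G \<and> cyclic_group (G\<lparr>carrier := N\<rparr>) \<and> cyclic_group (G Mod N))"

end

theory Submission
  imports Defs
begin

text \<open>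
  Write \<open>[x,y] = x y x^-1 y^-1\<close> and \<open>\<gamma> i\<close> for the terms of the lower central series. A group of prime
  power order is nilpotent, so to place \<open>\<gamma> i\<close> in a normal subgroup it is enough to do so modulo
  \<open>\<gamma> (i + 1)\<close> (\<open>lc_subset_of_supplement\<close>). The quotient
  \<open>G / \<gamma> 2\<close> is elementary abelian of order 9; hence \<open>G\<close> is generated by two elements, all factors
  \<open>\<gamma> i / \<gamma> (i + 1)\<close> have exponent 3, and \<open>\<gamma> 2 / \<gamma> 3\<close> is generated by one commutator \<open>c\<close> and has
  order 3. What remains is an interplay of commutators and cubes, governed by one identity:
  with \<open>w = [g,u]\<close>, \<open>v = [u,w]\<close> and \<open>z = [u,v]\<close> one has \<open>[g,u^3] = w^3 v^3 z\<close> as soon as \<open>w\<close>, \<open>v\<close> and \<open>z\<close>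
  commute with each other (\<open>cmt_cube_right\<close>).

  If some \<open>x^3\<close> were outside \<open>\<gamma> 3\<close>, the identity would make \<open>x^3\<close> central modulo \<open>\<gamma> 4\<close>, and the series would
  stop at \<open>\<gamma> 3\<close>; but \<open>|G| \<ge> 81\<close> (\<open>cube_in_lc_3\<close>). Conversely, in a group of exponent 3 every
  element commutes with its conjugates, so two elements that generate it have a central
  commutator; applied to the quotient by the cubes this gives the other inclusion of \<open>G^3 = \<gamma> 3\<close>
  (\<open>lc_3_subset_cubes\<close>).

  A maximal subgroup is generated by \<open>\<gamma> 2\<close> and one element \<open>x\<close>. If \<open>g\<close> is a second generator of \<open>G\<close>, then
  \<open>x\<close> and its conjugates by \<open>g\<close> and \<open>g^2\<close> generate the maximal subgroup (\<open>maxsub_three_generated\<close>).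

  There always is a maximal subgroup \<open>H\<close> with \<open>|H:H'| \<le> 27\<close>. By the equality \<open>G^3 = \<gamma> 3\<close> some \<open>x^3\<close> is
  outside \<open>\<gamma> 4\<close>. It has the form \<open>[y,c]\<close> modulo \<open>\<gamma> 4\<close>, and \<open>x\<close> commutes with it; this relation
  among the commutators that generate \<open>\<gamma> 4\<close> modulo \<open>\<gamma> 5\<close> is enough to place all of \<open>\<gamma> 4\<close> into \<open>H'\<close> for a
  suitable \<open>H\<close> (\<open>exists_maxsub_large_derived\<close>), and then \<open>H'\<close> has index at most 3 in \<open>\<gamma> 3\<close>.

  If \<open>|G : \<gamma> 4| = 81\<close>, then some \<open>b\<close> outside \<open>\<gamma> 2\<close> centralizes \<open>\<gamma> 2\<close> modulo \<open>\<gamma> 4\<close>. With a second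
  generator \<open>a\<close>, the iterated commutators \<open>[a,...,a,[b,a]]\<close> generate the factors of the lower central
  series: each is, up to deeper terms, the inverse of the cube of the one two steps
  earlier, so that \<open>b\<close> acts on it as trivially as it did two steps before
  (\<open>lc_uniserial\<close>). All factors below \<open>\<gamma> 2\<close> then have order 3, which is maximal class.
\<close>

section \<open>Commutator identities\<close>

text \<open>
  The group is an explicit argument because commutators in a group and in its quotients are compared.
\<close>
definition cmt :: "('a, 'b) monoid_scheme \<Rightarrow> 'a \<Rightarrow> 'a \<Rightarrow> 'a" where
  "cmt G x y = x \<otimes>\<^bsub>G\<^esub> y \<otimes>\<^bsub>G\<^esub> inv\<^bsub>G\<^esub> x \<otimes>\<^bsub>G\<^esub> inv\<^bsub>G\<^esub> y"

context group
begin

lemma cancel_left: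
  assumes "x \<in> carrier G" "y \<in> carrier G"
  shows "inv x \<otimes> (x \<otimes> y) = y" "x \<otimes> (inv x \<otimes> y) = y"
  using assms by (simp_all flip: m_assoc)

text \<open>
  Rewriting to right-associated reduced words; it decides the identities that hold in every group.
\<close>
lemmas word_simps = m_assoc inv_mult_group cancel_left

lemma cmt_closed [simp]: "x \<in> carrier G \<Longrightarrow> y \<in> carrier G \<Longrightarrow> cmt G x y \<in> carrier G"
  by (simp add: cmt_def)

lemma inv_cmt: "x \<in> carrier G \<Longrightarrow> y \<in> carrier G \<Longrightarrow> inv (cmt G x y) = cmt G y x"
  by (simp add: cmt_def word_simps)

lemma conj_eq_cmt: "x \<in> carrier G \<Longrightarrow> y \<in> carrier G \<Longrightarrow> x \<otimes> y \<otimes> inv x = cmt G x y \<otimes> y"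
  by (simp add: cmt_def word_simps)

lemma cmt_eq_one_iff:
  assumes "x \<in> carrier G" "y \<in> carrier G"
  shows "cmt G x y = \<one> \<longleftrightarrow> x \<otimes> y = y \<otimes> x"
proof -
  have e: "cmt G x y = (x \<otimes> y) \<otimes> inv (y \<otimes> x)" using assms by (simp add: cmt_def word_simps)
  show ?thesis
  proof
    assume "cmt G x y = \<one>"
    thus "x \<otimes> y = y \<otimes> x" using e assms
      by (metis inv_inv inv_equality m_closed inv_closed)
  next
    assume "x \<otimes> y = y \<otimes> x" thus "cmt G x y = \<one>" using e assms by simp
  qed
qed

lemma conj_cmt:
  assumes "g \<in> carrier G" "x \<in> carrier G" "y \<in> carrier G"
  shows "g \<otimes> cmt G x y \<otimes> inv g = cmt G (g \<otimes> x \<otimes> inv g) (g \<otimes> y \<otimes> inv g)"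
  using assms by (simp add: cmt_def word_simps)

lemma cmt_mult_right:
  assumes "x \<in> carrier G" "y \<in> carrier G" "z \<in> carrier G"
  shows "cmt G x (y \<otimes> z) = cmt G x y \<otimes> (y \<otimes> cmt G x z \<otimes> inv y)"
  using assms by (simp add: cmt_def word_simps)

lemma cmt_mult_left:
  assumes "x \<in> carrier G" "y \<in> carrier G" "z \<in> carrier G"
  shows "cmt G (x \<otimes> y) z = (x \<otimes> cmt G y z \<otimes> inv x) \<otimes> cmt G x z"
  using assms by (simp add: cmt_def word_simps)

text \<open>
  The form in which central factors arise is conjugation: \<open>u x u^-1 = [u,x] x\<close>, where
  \<open>[u,x]\<close> may be central although \<open>u\<close> and \<open>x\<close> are not.
\<close>
lemma cmt_central_mult:
  assumes c: "a \<in> carrier G" "b \<in> carrier G" and x: "x \<in> carrier G" and y: "y \<in> carrier G"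
    and a: "\<And>t. t \<in> carrier G \<Longrightarrow> a \<otimes> t = t \<otimes> a"
    and b: "\<And>t. t \<in> carrier G \<Longrightarrow> b \<otimes> t = t \<otimes> b"
  shows "cmt G (a \<otimes> x) (b \<otimes> y) = cmt G x y"
proof -
  have fix_a: "a \<otimes> t \<otimes> inv a = t" if "t \<in> carrier G" for t using a[OF that] that c by (simp add: m_assoc)
  have fix_b: "b \<otimes> t \<otimes> inv b = t" if "t \<in> carrier G" for t using b[OF that] that c by (simp add: m_assoc)
  have one: "cmt G a t = \<one>" "cmt G t b = \<one>" if "t \<in> carrier G" for t
    using a b c that by (simp_all add: cmt_eq_one_iff)
  have "cmt G (a \<otimes> x) (b \<otimes> y) = cmt G x (b \<otimes> y)"
    using cmt_mult_left[of a x "b \<otimes> y"] c x y fix_a one by simp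
  also have "\<dots> = cmt G x y"
    using cmt_mult_right[of x b y] c x y fix_b one by simp
  finally show ?thesis .
qed

lemma cube_eq: "x \<in> carrier G \<Longrightarrow> x [^] (3::nat) = x \<otimes> x \<otimes> x"
  by (simp add: numeral_3_eq_3 m_assoc)

lemma conj_cube:
  assumes "g \<in> carrier G" "x \<in> carrier G"
  shows "g \<otimes> x [^] (3::nat) \<otimes> inv g = (g \<otimes> x \<otimes> inv g) [^] (3::nat)"
  using assms by (simp add: cube_eq word_simps)

text \<open>
  Since \<open>g u g^-1 = w u\<close>, the commutator equals
  \<open>(w u)^3 u^-3 = w (u w u^-1) (u^2 w u^-2)\<close>, and the two conjugates of \<open>w\<close> are \<open>v w\<close> and \<open>z v v w\<close>.
  This identity links the power structure to the lower central series and is behind every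
  statement about cubes below.
\<close>
lemma cmt_cube_right:
  assumes g: "g \<in> carrier G" and u: "u \<in> carrier G"
    and w: "w = cmt G g u" and v: "v = cmt G u w" and z: "z = cmt G u v"
    and vw: "v \<otimes> w = w \<otimes> v" and zw: "z \<otimes> w = w \<otimes> z" and zv: "z \<otimes> v = v \<otimes> z"
  shows "cmt G g (u [^] (3::nat)) = w [^] (3::nat) \<otimes> v [^] (3::nat) \<otimes> z"
proof -
  have c: "w \<in> carrier G" "v \<in> carrier G" "z \<in> carrier G" using assms by auto
  have "cmt G g (u [^] (3::nat)) = (g \<otimes> u \<otimes> inv g) [^] (3::nat) \<otimes> inv (u [^] (3::nat))"
    using g u by (simp add: conj_cube[symmetric] cmt_def)
  also have "g \<otimes> u \<otimes> inv g = w \<otimes> u" using conj_eq_cmt[OF g u] w by simp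
  also have "(w \<otimes> u) [^] (3::nat) \<otimes> inv (u [^] (3::nat))
     = w \<otimes> (u \<otimes> w \<otimes> inv u) \<otimes> (u \<otimes> (u \<otimes> w \<otimes> inv u) \<otimes> inv u)"
    using c u by (simp add: cube_eq word_simps)
  also have "u \<otimes> w \<otimes> inv u = v \<otimes> w" using conj_eq_cmt[OF u c(1)] v by simp
  also have "u \<otimes> (v \<otimes> w) \<otimes> inv u = (u \<otimes> v \<otimes> inv u) \<otimes> (u \<otimes> w \<otimes> inv u)"
    using c u by (simp add: word_simps)
  also have "\<dots> = z \<otimes> v \<otimes> (v \<otimes> w)"
    using conj_eq_cmt[OF u c(1)] conj_eq_cmt[OF u c(2)] v z by simp
  also have "w \<otimes> (v \<otimes> w) \<otimes> (z \<otimes> v \<otimes> (v \<otimes> w)) = w [^] (3::nat) \<otimes> v [^] (3::nat) \<otimes> z"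
  proof -
    have vw': "v \<otimes> (w \<otimes> y) = w \<otimes> (v \<otimes> y)" if "y \<in> carrier G" for y
      using vw that c by (metis m_assoc)
    have zw': "z \<otimes> (w \<otimes> y) = w \<otimes> (z \<otimes> y)" if "y \<in> carrier G" for y
      using zw that c by (metis m_assoc)
    have zv': "z \<otimes> (v \<otimes> y) = v \<otimes> (z \<otimes> y)" if "y \<in> carrier G" for y
      using zv that c by (metis m_assoc)
    show ?thesis using c by (simp add: cube_eq m_assoc vw vw' zw zw' zv zv')
  qed
  finally show ?thesis .
qed

text \<open>
  A substitute for the Jacobi identity. The conjugates of \<open>w\<close> by \<open>a b\<close> and by \<open>b a\<close> differ by
  conjugation with \<open>k = [b,a]\<close>, which commutes with all factors that occur; the two expansions
  have the factors \<open>p\<close>, \<open>q\<close> and \<open>w\<close> in common, and what is left over is the claim.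
\<close>
lemma cmt_cmt_commute:
  assumes a: "a \<in> carrier G" and b: "b \<in> carrier G" and w: "w \<in> carrier G"
    and p: "p = cmt G a w" and q: "q = cmt G b w"
    and pq: "p \<otimes> q = q \<otimes> p"
    and k: "k = cmt G b a" and kw: "k \<otimes> w = w \<otimes> k" and kp: "k \<otimes> p = p \<otimes> k"
    and kq: "k \<otimes> q = q \<otimes> k" and ka: "k \<otimes> cmt G a q = cmt G a q \<otimes> k"
  shows "cmt G a (cmt G b w) = cmt G b (cmt G a w)"
proof -
  have c: "p \<in> carrier G" "q \<in> carrier G" "k \<in> carrier G" using assms by auto
  define r where "r = cmt G a q"
  define t where "t = cmt G b p"
  have rt: "r \<in> carrier G" "t \<in> carrier G" unfolding r_def t_def using c a b by auto
  have 1: "a \<otimes> (b \<otimes> w \<otimes> inv b) \<otimes> inv a = r \<otimes> q \<otimes> (p \<otimes> w)"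
  proof -
    have "a \<otimes> (b \<otimes> w \<otimes> inv b) \<otimes> inv a = a \<otimes> (q \<otimes> w) \<otimes> inv a"
      using conj_eq_cmt[OF b w] q by simp
    also have "\<dots> = (a \<otimes> q \<otimes> inv a) \<otimes> (a \<otimes> w \<otimes> inv a)" using a c w by (simp add: word_simps)
    finally show ?thesis using conj_eq_cmt[OF a w] conj_eq_cmt[OF a c(2)] p r_def by simp
  qed
  have 2: "b \<otimes> (a \<otimes> w \<otimes> inv a) \<otimes> inv b = t \<otimes> p \<otimes> (q \<otimes> w)"
  proof -
    have "b \<otimes> (a \<otimes> w \<otimes> inv a) \<otimes> inv b = b \<otimes> (p \<otimes> w) \<otimes> inv b"
      using conj_eq_cmt[OF a w] p by simp
    also have "\<dots> = (b \<otimes> p \<otimes> inv b) \<otimes> (b \<otimes> w \<otimes> inv b)" using b c w by (simp add: word_simps)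
    finally show ?thesis using conj_eq_cmt[OF b w] conj_eq_cmt[OF b c(1)] q t_def by simp
  qed
  have k1: "k \<otimes> (r \<otimes> q \<otimes> (p \<otimes> w)) = r \<otimes> q \<otimes> (p \<otimes> w) \<otimes> k"
  proof -
    have kr: "k \<otimes> r = r \<otimes> k" using ka r_def by simp
    have "k \<otimes> (r \<otimes> y) = r \<otimes> (k \<otimes> y)" "k \<otimes> (q \<otimes> y) = q \<otimes> (k \<otimes> y)"
      "k \<otimes> (p \<otimes> y) = p \<otimes> (k \<otimes> y)" if "y \<in> carrier G" for y
      using that kr kp kq c rt by (metis m_assoc)+
    thus ?thesis using c rt w kw by (simp add: m_assoc)
  qed
  have "b \<otimes> (a \<otimes> w \<otimes> inv a) \<otimes> inv b = k \<otimes> (a \<otimes> (b \<otimes> w \<otimes> inv b) \<otimes> inv a) \<otimes> inv k"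
    unfolding k using a b w by (simp add: cmt_def word_simps)
  also have "\<dots> = k \<otimes> (r \<otimes> q \<otimes> (p \<otimes> w)) \<otimes> inv k" using 1 by simp
  also have "\<dots> = r \<otimes> q \<otimes> (p \<otimes> w)" using k1 c rt w by (simp add: word_simps)
  also have "\<dots> = r \<otimes> (p \<otimes> (q \<otimes> w))" using c rt w pq by (metis m_assoc m_closed)
  finally have "t \<otimes> (p \<otimes> (q \<otimes> w)) = r \<otimes> (p \<otimes> (q \<otimes> w))"
    using 2 c rt w by (simp add: m_assoc)
  hence "t = r" using c rt w by simp
  thus ?thesis by (simp add: t_def r_def p q)
qed

text \<open>
  Groups of exponent 3 are 2-Engel. The equation \<open>(w y)^3 y^-3 = 1\<close> says that \<open>w\<close>, its conjugate
  by \<open>y\<close> and its conjugate by \<open>y^2\<close> have product 1. For \<open>y = x\<close> and for \<open>y = x^-1\<close> these are the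
  same two conjugates \<open>p\<close>, \<open>q\<close> in the two possible orders, so \<open>w p q = w q p = 1\<close>, which forces \<open>w\<close> to
  commute with \<open>p = x w x^-1\<close>.
\<close>
lemma exponent_three_engel:
  assumes cubes: "\<And>x. x \<in> carrier G \<Longrightarrow> x [^] (3::nat) = \<one>"
    and w: "w \<in> carrier G" and x: "x \<in> carrier G"
  shows "cmt G w (cmt G w x) = \<one>"
proof -
  have n: "w \<otimes> (y \<otimes> w \<otimes> inv y) \<otimes> (y \<otimes> (y \<otimes> w \<otimes> inv y) \<otimes> inv y) = \<one>" if y: "y \<in> carrier G" for y
  proof -
    have "(w \<otimes> y) [^] (3::nat) \<otimes> inv (y [^] (3::nat)) = \<one>" using cubes w y by simp
    moreover have "(w \<otimes> y) [^] (3::nat) \<otimes> inv (y [^] (3::nat))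
      = w \<otimes> (y \<otimes> w \<otimes> inv y) \<otimes> (y \<otimes> (y \<otimes> w \<otimes> inv y) \<otimes> inv y)"
      using w y by (simp add: cube_eq word_simps)
    ultimately show ?thesis by simp
  qed
  define p where "p = x \<otimes> w \<otimes> inv x"
  define q where "q = inv x \<otimes> w \<otimes> x"
  have pq: "p \<in> carrier G" "q \<in> carrier G" unfolding p_def q_def using w x by auto
  have x2: "inv x \<otimes> inv x = x" "x \<otimes> x = inv x"
  proof -
    have "x \<otimes> x \<otimes> x = \<one>" using cubes[OF x] cube_eq[OF x] by simp
    thus "x \<otimes> x = inv x" using x by (metis inv_equality m_closed)
    hence "inv (x \<otimes> x) = inv (inv x)" by simp
    thus "inv x \<otimes> inv x = x" using x by (simp add: inv_mult_group)
  qed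
  have "x \<otimes> (x \<otimes> w \<otimes> inv x) \<otimes> inv x = (x \<otimes> x) \<otimes> w \<otimes> (inv x \<otimes> inv x)"
    using w x by (simp add: word_simps)
  hence xx: "x \<otimes> (x \<otimes> w \<otimes> inv x) \<otimes> inv x = q" using x2 q_def by simp
  have "inv x \<otimes> (inv x \<otimes> w \<otimes> x) \<otimes> x = (inv x \<otimes> inv x) \<otimes> w \<otimes> (x \<otimes> x)"
    using w x by (simp add: word_simps)
  hence yy: "inv x \<otimes> (inv x \<otimes> w \<otimes> x) \<otimes> x = p" using x2 p_def by simp
  have 1: "w \<otimes> p \<otimes> q = \<one>" using n[OF x] xx p_def by simp
  have 2: "w \<otimes> q \<otimes> p = \<one>" using n[OF inv_closed[OF x]] yy q_def x by simp
  have "w \<otimes> (p \<otimes> q) = \<one>" using 1 w pq by (simp add: m_assoc)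
  hence "p \<otimes> q \<otimes> w = \<one>" using w pq by (metis inv_comm m_closed)
  hence "p \<otimes> (q \<otimes> w) = \<one>" using w pq by (simp add: m_assoc)
  hence "q \<otimes> w \<otimes> p = \<one>" using w pq by (metis inv_comm m_closed)
  hence "q \<otimes> (w \<otimes> p) = \<one>" using w pq by (simp add: m_assoc)
  moreover have "q \<otimes> (p \<otimes> w) = \<one>"
  proof -
    have "w \<otimes> (q \<otimes> p) = \<one>" using 2 w pq by (simp add: m_assoc)
    hence "(q \<otimes> p) \<otimes> w = \<one>" using w pq by (metis inv_comm m_closed)
    thus ?thesis using w pq by (simp add: m_assoc)
  qed
  ultimately have com: "w \<otimes> p = p \<otimes> w" using w pq by (metis l_cancel m_closed)
  have "cmt G w x = w \<otimes> inv p" unfolding p_def using w x by (simp add: cmt_def word_simps)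
  moreover have "w \<otimes> inv p = inv p \<otimes> w" using com w pq
    by (metis inv_closed inv_solve_left inv_solve_right m_assoc m_closed)
  ultimately have "w \<otimes> cmt G w x = cmt G w x \<otimes> w" using w pq by (metis m_assoc inv_closed)
  thus ?thesis using cmt_eq_one_iff w x by simp
qed

end

section \<open>Commutators modulo a normal subgroup\<close>

lemma (in group_hom) hom_cmt:
  "x \<in> carrier G \<Longrightarrow> y \<in> carrier G \<Longrightarrow> h (cmt G x y) = cmt H (h x) (h y)"
  by (simp add: cmt_def)

text \<open>
  A surjective homomorphism with kernel \<open>N\<close>. Congruences modulo \<open>N\<close> are proved as equations in the
  target, and the target is kept abstract so that its elements do not unfold to cosets.
\<close>
locale quotient_map = group_hom +
  fixes N
  assumes trivial_iff: "x \<in> carrier G \<Longrightarrow> h x = \<one>\<^bsub>H\<^esub> \<longleftrightarrow> x \<in> N"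
    and onto: "h ` carrier G = carrier H"

context quotient_map
begin

lemma eq_iff:
  assumes "x \<in> carrier G" "y \<in> carrier G"
  shows "h x = h y \<longleftrightarrow> x \<otimes> inv y \<in> N"
proof -
  have "h x = h y \<longleftrightarrow> h (x \<otimes> inv y) = \<one>\<^bsub>H\<^esub>"
    using assms H.inv_solve_right'[of "\<one>\<^bsub>H\<^esub>" "h x" "h y"] by (auto simp: hom_mult)
  thus ?thesis using trivial_iff[of "x \<otimes> inv y"] assms by simp
qed

lemma commute_iff:
  assumes "x \<in> carrier G" "y \<in> carrier G"
  shows "h x \<otimes>\<^bsub>H\<^esub> h y = h y \<otimes>\<^bsub>H\<^esub> h x \<longleftrightarrow> cmt G x y \<in> N"
  using assms H.cmt_eq_one_iff[of "h x" "h y"] trivial_iff[of "cmt G x y"] hom_cmt by simp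

end

context group
begin

lemma quotient_map_exists:
  assumes "N \<lhd> G"
  shows "\<exists>(Q :: 'a set monoid) q. quotient_map G Q q N"
proof -
  interpret N: normal N G by fact
  let ?q = "\<lambda>x. N #> x"
  interpret h: group_hom G "G Mod N" ?q
    using N.r_coset_hom_Mod N.factorgroup_is_group
    by (simp add: group_hom.intro group_hom_axioms.intro)
  have "quotient_map G (G Mod N) ?q N"
  proof
    show "?q x = \<one>\<^bsub>G Mod N\<^esub> \<longleftrightarrow> x \<in> N" if "x \<in> carrier G" for x
      using that N.subgroup_axioms coset_join1 coset_join2 N.subset by (metis one_FactGroup)
    show "?q ` carrier G = carrier (G Mod N)" by (simp add: carrier_FactGroup)
  qed
  thus ?thesis by blast
qed

lemma normal_conj: "N \<lhd> G \<Longrightarrow> x \<in> N \<Longrightarrow> g \<in> carrier G \<Longrightarrow> g \<otimes> x \<otimes> inv g \<in> N"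
  using normal_inv_iff by blast

lemma cmt_mem_swap:
  assumes "subgroup N G" "x \<in> carrier G" "y \<in> carrier G" "cmt G x y \<in> N"
  shows "cmt G y x \<in> N"
  using subgroup.m_inv_closed[OF assms(1,4)] inv_cmt[OF assms(2,3)] by simp

lemma cmt_mem_normal:
  assumes "N \<lhd> G" "x \<in> N" "g \<in> carrier G"
  shows "cmt G x g \<in> N" "cmt G g x \<in> N"
proof -
  have c: "x \<in> carrier G" using assms normal_imp_subgroup subgroup.subset by blast
  have "g \<otimes> x \<otimes> inv g \<otimes> inv x \<in> N"
    using assms normal_conj[OF assms] normal_imp_subgroup subgroup.m_closed subgroup.m_inv_closed by metis
  thus 1: "cmt G g x \<in> N" by (simp add: cmt_def)
  show "cmt G x g \<in> N" using cmt_mem_swap[OF normal_imp_subgroup[OF assms(1)] assms(3) c 1] .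
qed

text \<open>
  The preimage of a centralizer in the quotient by \<open>N\<close>. That it is a subgroup is why commutator
  conditions modulo \<open>N\<close> need to be checked on generators only.
\<close>
lemma centralizer_mod_subgroup:
  assumes N: "N \<lhd> G" and s: "s \<in> carrier G"
  shows "subgroup {g \<in> carrier G. cmt G s g \<in> N} G"
proof -
  interpret N: normal N G by fact
  show ?thesis
  proof (rule subgroupI)
    show "{g \<in> carrier G. cmt G s g \<in> N} \<noteq> {}"
      using s N.one_closed by (auto intro!: exI[of _ \<one>] simp: cmt_def)
    fix g assume g: "g \<in> {g \<in> carrier G. cmt G s g \<in> N}"
    have "cmt G s (inv g) = inv g \<otimes> inv (cmt G s g) \<otimes> inv (inv g)"
      using g s by (simp add: cmt_def word_simps)
    thus "inv g \<in> {g \<in> carrier G. cmt G s g \<in> N}"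
      using g normal_conj[OF N, of "inv (cmt G s g)" "inv g"] by simp
    fix h assume "h \<in> {g \<in> carrier G. cmt G s g \<in> N}"
    thus "g \<otimes> h \<in> {g \<in> carrier G. cmt G s g \<in> N}"
      using g s normal_conj[OF N] by (simp add: cmt_mult_right)
  qed auto
qed

lemma cmt_mem_generate_right:
  assumes "N \<lhd> G" "s \<in> carrier G" "T \<subseteq> carrier G" "\<And>t. t \<in> T \<Longrightarrow> cmt G s t \<in> N"
    "g \<in> generate G T"
  shows "cmt G s g \<in> N"
  using generate_subgroup_incl[OF _ centralizer_mod_subgroup[OF assms(1,2)], of T] assms by blast

lemma cmt_mem_generate:
  assumes N: "N \<lhd> G" and S: "S \<subseteq> carrier G" and T: "T \<subseteq> carrier G"
    and st: "\<And>s t. s \<in> S \<Longrightarrow> t \<in> T \<Longrightarrow> cmt G s t \<in> N"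
    and x: "x \<in> generate G S" and y: "y \<in> generate G T"
  shows "cmt G x y \<in> N"
proof -
  have xc: "x \<in> carrier G" and yc: "y \<in> carrier G" using x y S T generate_in_carrier by blast+
  have "cmt G y s \<in> N" if s: "s \<in> S" for s
    using cmt_mem_swap[OF normal_imp_subgroup[OF N] _ yc] cmt_mem_generate_right[OF N _ T st[OF s] y] s S by blast
  hence "cmt G y x \<in> N" using cmt_mem_generate_right[OF N yc S _ x] by blast
  thus ?thesis using cmt_mem_swap[OF normal_imp_subgroup[OF N] yc xc] by blast
qed

end

section \<open>The lower central series\<close>

context group
begin

abbreviation gam ("\<gamma>") where "\<gamma> \<equiv> lower_central G"

lemma lc_1 [simp]: "\<gamma> (Suc 0) = carrier G"
  using lower_central_1[of G] by simp

lemma lc_0: "\<gamma> 0 = carrier G"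
  by (simp add: lower_central_def)

lemma commutator_subgroup_alt:
  "commutator_subgroup G H K = generate G {cmt G h k | h k. h \<in> H \<and> k \<in> K}"
  unfolding commutator_subgroup_def cmt_def
  by (rule arg_cong[where f = "generate G"]) auto

lemma commutator_subgroup_normal:
  assumes "H \<lhd> G"
  shows "commutator_subgroup G H (carrier G) \<lhd> G"
  unfolding commutator_subgroup_alt
proof (rule normal_generateI)
  have H: "H \<subseteq> carrier G" using normal_imp_subgroup[OF assms] subgroup.subset by blast
  thus "{cmt G h k |h k. h \<in> H \<and> k \<in> carrier G} \<subseteq> carrier G" by auto
  fix x g assume x: "x \<in> {cmt G h k |h k. h \<in> H \<and> k \<in> carrier G}" and g: "g \<in> carrier G"
  then obtain h k where hk: "h \<in> H" "k \<in> carrier G" "x = cmt G h k" by blast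
  have "g \<otimes> x \<otimes> inv g = cmt G (g \<otimes> h \<otimes> inv g) (g \<otimes> k \<otimes> inv g)"
    using conj_cmt g hk H by blast
  moreover have "g \<otimes> h \<otimes> inv g \<in> H" using normal_conj[OF assms] g hk by blast
  moreover have "g \<otimes> k \<otimes> inv g \<in> carrier G" using g hk by auto
  ultimately show "g \<otimes> x \<otimes> inv g \<in> {cmt G h k |h k. h \<in> H \<and> k \<in> carrier G}" by blast
qed

lemma lc_normal: "\<gamma> i \<lhd> G"
proof (induction i)
  case 0 show ?case by (simp add: lc_0 normal_self)
next
  case (Suc i)
  show ?case
  proof (cases "i = 0")
    case True thus ?thesis by (simp add: normal_self)
  next
    case False
    hence "\<gamma> (Suc i) = commutator_subgroup G (\<gamma> i) (carrier G)"
      using lower_central_Suc[of i G] by simp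
    thus ?thesis using commutator_subgroup_normal[OF Suc] by simp
  qed
qed

lemma lc_subgroup: "subgroup (\<gamma> i) G"
  by (rule normal_imp_subgroup[OF lc_normal])

lemma lc_subset: "\<gamma> i \<subseteq> carrier G"
  using lc_subgroup subgroup.subset by blast

lemma lc_closed: "x \<in> \<gamma> i \<Longrightarrow> x \<in> carrier G"
  using lc_subset by blast

lemma cmt_lc:
  assumes "1 \<le> i" "x \<in> \<gamma> i" "g \<in> carrier G"
  shows "cmt G x g \<in> \<gamma> (Suc i)" "cmt G g x \<in> \<gamma> (Suc i)"
proof -
  have "\<gamma> (Suc i) = generate G {cmt G h k | h k. h \<in> \<gamma> i \<and> k \<in> carrier G}"
    using lower_central_Suc[OF assms(1), of G] by (simp add: commutator_subgroup_alt)
  thus 1: "cmt G x g \<in> \<gamma> (Suc i)" using assms by (auto intro: generate.incl)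
  show "cmt G g x \<in> \<gamma> (Suc i)"
    using cmt_mem_swap[OF lc_subgroup _ _ 1] assms lc_closed by blast
qed

lemma lc_Suc_least:
  assumes "1 \<le> i" "subgroup N G"
    and "\<And>x g. x \<in> \<gamma> i \<Longrightarrow> g \<in> carrier G \<Longrightarrow> cmt G x g \<in> N"
  shows "\<gamma> (Suc i) \<subseteq> N"
proof -
  have "\<gamma> (Suc i) = generate G {cmt G h k | h k. h \<in> \<gamma> i \<and> k \<in> carrier G}"
    using lower_central_Suc[OF assms(1), of G] by (simp add: commutator_subgroup_alt)
  also have "\<dots> \<subseteq> N" by (rule generate_subgroup_incl[OF _ assms(2)]) (use assms(3) in auto)
  finally show ?thesis .
qed

lemma lc_Suc_generate_least:
  assumes "1 \<le> i" "N \<lhd> G" "S \<subseteq> carrier G" "T \<subseteq> carrier G"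
    and "\<gamma> i \<subseteq> generate G S" "generate G T = carrier G"
    and "\<And>s t. s \<in> S \<Longrightarrow> t \<in> T \<Longrightarrow> cmt G s t \<in> N"
  shows "\<gamma> (Suc i) \<subseteq> N"
proof (rule lc_Suc_least[OF assms(1) normal_imp_subgroup[OF assms(2)]])
  fix x g assume "x \<in> \<gamma> i" "g \<in> carrier G"
  thus "cmt G x g \<in> N" using cmt_mem_generate[OF assms(2-4,7)] assms(5,6) by blast
qed

lemma lc_Suc_subset: "\<gamma> (Suc i) \<subseteq> \<gamma> i"
proof (cases "i = 0")
  case True thus ?thesis by (simp add: lc_0)
next
  case False
  thus ?thesis using lc_Suc_least[of i "\<gamma> i"] lc_subgroup cmt_mem_normal[OF lc_normal] by simp
qed

lemma lc_antimono: "i \<le> j \<Longrightarrow> \<gamma> j \<subseteq> \<gamma> i"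
  using lift_Suc_antimono_le[of "\<gamma>"] lc_Suc_subset by blast

text \<open>
  The group acts trivially by conjugation on the factor between two successive terms.
\<close>
lemma sandwich_normal:
  assumes "1 \<le> i" "subgroup T G" "\<gamma> (Suc i) \<subseteq> T" "T \<subseteq> \<gamma> i"
  shows "T \<lhd> G"
proof (rule normal_invI[OF assms(2)])
  fix g h assume g: "g \<in> carrier G" and h: "h \<in> T"
  have hc: "h \<in> carrier G" using h assms(4) lc_closed by blast
  have "g \<otimes> h \<otimes> inv g = cmt G g h \<otimes> h" using conj_eq_cmt g hc by blast
  moreover have "cmt G g h \<in> T" using cmt_lc(2)[OF assms(1) _ g] h assms by blast
  ultimately show "g \<otimes> h \<otimes> inv g \<in> T" using subgroup.m_closed[OF assms(2)] h by simp
qed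

text \<open>
  Modulo \<open>\<gamma> (i + 2)\<close> conjugation by \<open>u\<close> multiplies each element by a central one, and central
  factors cancel in commutators. So \<open>u\<close> commutes with all commutators. This gains one step
  over the defining property of the series.
\<close>
lemma cmt_lc_derived:
  assumes i: "1 \<le> i" and u: "u \<in> \<gamma> i" and v: "v \<in> \<gamma> 2"
  shows "cmt G u v \<in> \<gamma> (Suc (Suc i))" "cmt G v u \<in> \<gamma> (Suc (Suc i))"
proof -
  let ?N = "\<gamma> (Suc (Suc i))"
  obtain Q :: "'a set monoid" and q where "quotient_map G Q q ?N"
    using quotient_map_exists[OF lc_normal] by blast
  then interpret q: quotient_map G Q q ?N .
  note ker = q.trivial_iff and qc = q.hom_cmt and onto = q.onto
  have uc: "u \<in> carrier G" using u lc_closed by blast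
  have vc: "v \<in> carrier G" using v lc_closed by blast
  have central: "q z \<otimes>\<^bsub>Q\<^esub> q y = q y \<otimes>\<^bsub>Q\<^esub> q z"
    if "z \<in> \<gamma> (Suc i)" "y \<in> carrier G" for z y
    using that cmt_lc(1)[of "Suc i" z y] ker qc lc_closed q.H.cmt_eq_one_iff
    by (metis cmt_closed le_add1 plus_1_eq_Suc q.hom_closed)
  have "cmt G u (cmt G x y) \<in> ?N" if x: "x \<in> carrier G" and y: "y \<in> carrier G" for x y
  proof -
    define \<alpha> where "\<alpha> = cmt Q (q u) (q x)"
    define \<beta> where "\<beta> = cmt Q (q u) (q y)"
    have \<alpha>': "\<alpha> = q (cmt G u x)" "\<beta> = q (cmt G u y)" using qc uc x y \<alpha>_def \<beta>_def by auto
    have c: "\<alpha> \<in> carrier Q" "\<beta> \<in> carrier Q" using uc x y \<alpha>_def \<beta>_def by auto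
    have com: "\<alpha> \<otimes>\<^bsub>Q\<^esub> t = t \<otimes>\<^bsub>Q\<^esub> \<alpha>" "\<beta> \<otimes>\<^bsub>Q\<^esub> t = t \<otimes>\<^bsub>Q\<^esub> \<beta>" if "t \<in> carrier Q" for t
    proof -
      obtain y' where "y' \<in> carrier G" "t = q y'" using \<open>t \<in> carrier Q\<close> onto by blast
      thus "\<alpha> \<otimes>\<^bsub>Q\<^esub> t = t \<otimes>\<^bsub>Q\<^esub> \<alpha>" "\<beta> \<otimes>\<^bsub>Q\<^esub> t = t \<otimes>\<^bsub>Q\<^esub> \<beta>"
        using central[OF cmt_lc(1)[OF i u x]] central[OF cmt_lc(1)[OF i u y]] \<alpha>' by auto
    qed
    have "q u \<otimes>\<^bsub>Q\<^esub> cmt Q (q x) (q y) \<otimes>\<^bsub>Q\<^esub> inv\<^bsub>Q\<^esub> (q u)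
      = cmt Q (\<alpha> \<otimes>\<^bsub>Q\<^esub> q x) (\<beta> \<otimes>\<^bsub>Q\<^esub> q y)"
      using q.H.conj_cmt q.H.conj_eq_cmt uc x y \<alpha>_def \<beta>_def by auto
    also have "\<dots> = cmt Q (q x) (q y)"
      by (rule q.H.cmt_central_mult) (use c x y com in auto)
    finally have "q u \<otimes>\<^bsub>Q\<^esub> cmt Q (q x) (q y) = cmt Q (q x) (q y) \<otimes>\<^bsub>Q\<^esub> q u"
      using uc x y q.H.inv_solve_right' by (metis q.H.cmt_closed q.H.m_closed q.hom_closed)
    hence "cmt Q (q u) (cmt Q (q x) (q y)) = \<one>\<^bsub>Q\<^esub>" using q.H.cmt_eq_one_iff uc x y by simp
    hence "q (cmt G u (cmt G x y)) = \<one>\<^bsub>Q\<^esub>" by (simp add: q.hom_cmt uc x y)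
    thus ?thesis using ker uc x y by simp
  qed
  moreover have "{cmt G h k | h k. h \<in> carrier G \<and> k \<in> carrier G} \<subseteq> carrier G" by auto
  moreover have "\<gamma> 2 = generate G {cmt G h k | h k. h \<in> carrier G \<and> k \<in> carrier G}"
    using lower_central_Suc[of 1 G] by (simp add: commutator_subgroup_alt numeral_2_eq_2)
  ultimately show 1: "cmt G u v \<in> ?N"
    using cmt_mem_generate_right[OF lc_normal uc, of "{cmt G h k | h k. h \<in> carrier G \<and> k \<in> carrier G}" _ v] v
    by blast
  show "cmt G v u \<in> ?N" using cmt_mem_swap[OF lc_subgroup uc vc 1] .
qed

text \<open>
  Conjugation by the inverses of generators is a separate hypothesis because \<open>T\<close> may be infinite.
\<close>
lemma normal_of_generators:
  assumes T: "subgroup T G" and S: "S \<subseteq> carrier G" "generate G S = carrier G"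
    and n: "\<And>s t. s \<in> S \<Longrightarrow> t \<in> T \<Longrightarrow> s \<otimes> t \<otimes> inv s \<in> T"
    and n': "\<And>s t. s \<in> S \<Longrightarrow> t \<in> T \<Longrightarrow> inv s \<otimes> t \<otimes> s \<in> T"
  shows "T \<lhd> G"
proof (rule normal_invI[OF T])
  interpret T: subgroup T G by fact
  fix g t assume g: "g \<in> carrier G" and t: "t \<in> T"
  have "g \<in> generate G S" using g S by simp
  hence "\<forall>t\<in>T. g \<otimes> t \<otimes> inv g \<in> T"
  proof (induction g rule: generate.induct)
    case (eng g h)
    have c: "g \<in> carrier G" "h \<in> carrier G" using eng generate_in_carrier S by blast+
    have "g \<otimes> h \<otimes> t \<otimes> inv (g \<otimes> h) = g \<otimes> (h \<otimes> t \<otimes> inv h) \<otimes> inv g" if "t \<in> T" for t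
      using c that T.subset by (auto simp: word_simps)
    thus ?case using eng by simp
  qed (use n n' S T.subset in auto)
  thus "g \<otimes> t \<otimes> inv g \<in> T" using t by blast
qed

text \<open>
  In a nilpotent group the derived subgroup consists of non-generators. Suppose that \<open>S\<close> and
  \<open>\<gamma> j\<close> generate \<open>G\<close>, and let \<open>T\<close> be generated by \<open>S\<close> and \<open>\<gamma> (j + 1)\<close>. Both \<open>S\<close> and \<open>\<gamma> j\<close>
  normalize \<open>T\<close>, so \<open>T\<close> is normal, and generators of \<open>G\<close> commute modulo \<open>T\<close>; hence \<open>T\<close> contains the
  derived subgroup and is \<open>G\<close>. Thus \<open>j\<close> can be increased until \<open>\<gamma> j\<close> is trivial.
\<close>
lemma generate_of_generate_derived:
  assumes nilp: "\<gamma> k = {\<one>}" and S: "S \<subseteq> carrier G"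
    and gen: "generate G (S \<union> \<gamma> 2) = carrier G"
  shows "generate G S = carrier G"
proof -
  have "generate G (S \<union> \<gamma> (Suc (Suc i))) = carrier G" for i
  proof (induction i)
    case 0 thus ?case using gen by (simp add: numeral_2_eq_2)
  next
    case (Suc i)
    define j where "j = Suc (Suc i)"
    define T where "T = generate G (S \<union> \<gamma> (Suc j))"
    have jc: "S \<union> \<gamma> j \<subseteq> carrier G" "S \<union> \<gamma> (Suc j) \<subseteq> carrier G"
      using S lc_subset by blast+
    have T: "subgroup T G" unfolding T_def using generate_is_subgroup jc by blast
    interpret T: subgroup T G by fact
    have inT: "S \<subseteq> T" "\<gamma> (Suc j) \<subseteq> T" unfolding T_def by (auto intro: generate.incl)
    have cT: "cmt G x y \<in> T" if "x \<in> \<gamma> j" "y \<in> carrier G" for x y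
      using cmt_lc(1)[of j x y] that inT j_def by auto
    have z: "x \<otimes> t \<otimes> inv x \<in> T" if x: "x \<in> \<gamma> j" and t: "t \<in> T" for x t
      using conj_eq_cmt[of x t] cT[OF x, of t] t lc_closed[OF x] T.subset T.m_closed by auto
    have N: "T \<lhd> G"
    proof (rule normal_of_generators[OF T jc(1)])
      show "generate G (S \<union> \<gamma> j) = carrier G" using Suc j_def by simp
      fix s t assume s: "s \<in> S \<union> \<gamma> j" and t: "t \<in> T"
      show "s \<otimes> t \<otimes> inv s \<in> T" using s t z inT T.m_closed T.m_inv_closed by blast
      show "inv s \<otimes> t \<otimes> s \<in> T"
      proof (cases "s \<in> S")
        case True thus ?thesis using t inT T.m_closed T.m_inv_closed by blast
      next
        case False
        hence "s \<in> \<gamma> j" using s by simp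
        hence "inv s \<in> \<gamma> j" by (rule subgroup.m_inv_closed[OF lc_subgroup])
        thus ?thesis using z[of "inv s"] t s jc by auto
      qed
    qed
    have c: "cmt G s t \<in> T" if s: "s \<in> S \<union> \<gamma> j" and t: "t \<in> S \<union> \<gamma> j" for s t
    proof (cases "s \<in> S \<and> t \<in> S")
      case True thus ?thesis using inT T.m_closed T.m_inv_closed unfolding cmt_def by blast
    next
      case False
      thus ?thesis using s t cT cmt_mem_swap[OF T] jc by blast
    qed
    have "\<gamma> 2 \<subseteq> T"
      using lc_Suc_generate_least[of 1, OF _ N jc(1) jc(1) _ _ c] Suc j_def by (simp add: numeral_2_eq_2)
    hence "generate G (S \<union> \<gamma> 2) \<subseteq> T"
      using generate_subgroup_incl[OF _ T] inT by simp
    thus ?case using gen T.subset unfolding T_def j_def by auto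
  qed
  moreover have "\<gamma> (Suc (Suc k)) = {\<one>}"
    using lc_antimono[of k "Suc (Suc k)"] nilp subgroup.one_closed[OF lc_subgroup] by auto
  ultimately have "generate G (S \<union> {\<one>}) = carrier G" by metis
  moreover have "generate G (S \<union> {\<one>}) \<subseteq> generate G S"
    by (rule generate_subgroup_incl[OF _ generate_is_subgroup[OF S]]) (auto intro: generate.incl generate.one)
  ultimately show ?thesis using generate_incl[OF S] by blast
qed

text \<open>
  Commutators with \<open>G\<close> carry the inclusion of \<open>\<gamma> j\<close> in \<open>M \<gamma> (j + 1)\<close> from \<open>j\<close> to \<open>j + 1\<close>.
  So inclusions modulo the next term of the series are inclusions.
\<close>
lemma lc_subset_of_supplement:
  assumes nilp: "\<gamma> k = {\<one>}" and i: "1 \<le> i" and M: "M \<lhd> G"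
    and sub: "\<gamma> i \<subseteq> generate G (M \<union> \<gamma> (Suc i))"
  shows "\<gamma> i \<subseteq> M"
proof -
  interpret M: normal M G by fact
  have a: "\<gamma> j \<subseteq> generate G (M \<union> \<gamma> (Suc j))" if "i \<le> j" for j
    using that
  proof (induction j rule: dec_induct)
    case base show ?case by (rule sub)
  next
    case (step j)
    let ?T = "generate G (M \<union> \<gamma> (Suc (Suc j)))"
    have T: "?T \<lhd> G"
      by (rule normal_generateI) (use M.subset lc_subset normal_conj[OF M] normal_conj[OF lc_normal] in blast)+
    have c: "M \<union> \<gamma> (Suc j) \<subseteq> carrier G" using M.subset lc_subset by blast
    show ?case
    proof (rule lc_Suc_generate_least[OF _ T c subset_refl step.IH])
      show "1 \<le> j" using i step by simp
      show "generate G (carrier G) = carrier G" by (auto intro: generate.incl dest: generate_in_carrier[OF subset_refl])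
      fix s t assume s: "s \<in> M \<union> \<gamma> (Suc j)" and t: "t \<in> carrier G"
      show "cmt G s t \<in> ?T"
        using s t cmt_mem_normal[OF M] cmt_lc(1)[of "Suc j" s t] by (auto intro: generate.incl)
    qed
  qed
  have "\<gamma> i \<subseteq> generate G (M \<union> \<gamma> j)" if "i \<le> j" for j
    using that
  proof (induction j rule: dec_induct)
    case base show ?case by (auto intro: generate.incl)
  next
    case (step j)
    have "subgroup (generate G (M \<union> \<gamma> (Suc j))) G"
      using generate_is_subgroup M.subset lc_subset by simp
    hence "generate G (M \<union> \<gamma> j) \<subseteq> generate G (M \<union> \<gamma> (Suc j))"
      using generate_subgroup_incl a[of j] step generate.incl by (metis Un_least Un_upper1 subsetI subset_trans UnI1)
    thus ?case using step by blast
  qed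
  moreover have "\<gamma> (i + k) = {\<one>}"
    using lc_antimono[of k "i + k"] nilp subgroup.one_closed[OF lc_subgroup] by auto
  ultimately have "\<gamma> i \<subseteq> generate G (M \<union> {\<one>})" by (metis le_add1)
  also have "\<dots> \<subseteq> M" by (rule generate_subgroup_incl) (use M.subgroup_axioms M.one_closed in auto)
  finally show ?thesis .
qed

end

section \<open>Groups of prime power order\<close>

locale finite_p_group = group +
  fixes p :: nat
  assumes prime_p: "Factorial_Ring.prime p" and finite_carrier: "finite (carrier G)"
    and p_power: "\<exists>n. order G = p ^ n"
begin

lemma card_subgroup_p_power:
  assumes "subgroup H G"
  shows "\<exists>k. card H = p ^ k"
proof -
  have "card H dvd order G" using lagrange[OF assms] by (metis dvd_triv_right)
  thus ?thesis using p_power divides_primepow_nat[OF prime_p] by metis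
qed

lemma finite_subgroup: "subgroup H G \<Longrightarrow> finite H"
  using finite_carrier subgroup.subset finite_subset by metis

lemma card_psubset_subgroup:
  assumes "subgroup H G" "subgroup K G" "H \<subset> K"
  shows "p * card H \<le> card K"
proof -
  obtain h k where hk: "card H = p ^ h" "card K = p ^ k" using card_subgroup_p_power assms by metis
  have "card H < card K" using psubset_card_mono finite_subgroup assms by metis
  hence "h < k" using hk prime_gt_1_nat[OF prime_p] by (metis power_strict_increasing_iff)
  hence "p ^ Suc h \<le> p ^ k" using prime_gt_1_nat[OF prime_p] by (intro power_increasing) auto
  thus ?thesis using hk by simp
qed

lemma subgroup_finite_p_group:
  assumes "subgroup H G"
  shows "finite_p_group (G\<lparr>carrier := H\<rparr>) p"
proof -
  interpret H: group "G\<lparr>carrier := H\<rparr>" using subgroup_imp_group[OF assms] .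
  show ?thesis
    by unfold_locales (use prime_p finite_subgroup card_subgroup_p_power assms in \<open>auto simp: order_def\<close>)
qed

lemma quotient_finite_p_group:
  assumes "N \<lhd> G"
  shows "finite_p_group (G Mod N) p"
proof -
  interpret N: normal N G by fact
  interpret Q: group "G Mod N" by (rule N.factorgroup_is_group)
  have "order (G Mod N) dvd order G"
    using lagrange[OF N.subgroup_axioms] by (metis dvd_triv_left order_def FactGroup_def partial_object.simps(1))
  hence "\<exists>n. order (G Mod N) = p ^ n" using p_power divides_primepow_nat[OF prime_p] by metis
  thus ?thesis
    by unfold_locales (use prime_p finite_carrier in \<open>auto simp: carrier_FactGroup\<close>)
qed

text \<open>
  The class equation: if only the identity were fixed under conjugation, the orbits would be one
  singleton and sets of size divisible by \<open>p\<close>, and \<open>p\<close> would not divide the order.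
\<close>
lemma center_nontrivial:
  assumes "1 < order G"
  shows "\<exists>z\<in>carrier G. z \<noteq> \<one> \<and> (\<forall>g\<in>carrier G. z \<otimes> g = g \<otimes> z)"
proof (rule ccontr)
  assume neg: "\<not> ?thesis"
  let ?\<phi> = "\<lambda>g. \<lambda>h\<in>carrier G. g \<otimes> h \<otimes> inv g"
  interpret a: group_action G "carrier G" ?\<phi> by (rule action_by_conjugation)
  let ?O = "orbits G (carrier G) ?\<phi>"
  have orb: "orbit G ?\<phi> x = {g \<otimes> x \<otimes> inv g | g. g \<in> carrier G}" if "x \<in> carrier G" for x
    using that unfolding orbit_def by auto
  have one: "orbit G ?\<phi> \<one> = {\<one>}"
    unfolding orb[OF one_closed] by (auto intro: exI[of _ \<one>])
  have O1: "{\<one>} \<in> ?O" unfolding orbits_def using one by fastforce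
  have finO: "finite ?O" unfolding orbits_def using finite_carrier by simp
  have dv: "p dvd card C" if C: "C \<in> ?O - {{\<one>}}" for C
  proof -
    have "C \<in> ?O" using C by (rule DiffD1)
    then obtain x where x: "x \<in> carrier G" "C = orbit G ?\<phi> x"
      unfolding orbits_def mem_Collect_eq by iprover
    have "card C dvd order G" unfolding x(2) dvd_def
      by (rule exI, rule sym, rule a.orbit_stabilizer_theorem[OF x(1)])
    then obtain k where k: "card C = p ^ k" using p_power divides_primepow_nat[OF prime_p] by metis
    have "k \<noteq> 0"
    proof
      assume "k = 0"
      then obtain y where y: "C = {y}" using k card_1_singletonE by auto
      have "x \<in> C" using orb[OF x(1)] x by (auto intro!: exI[of _ \<one>])
      hence eq: "g \<otimes> x \<otimes> inv g = x" if "g \<in> carrier G" for g using y orb[OF x(1)] x that by blast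
      have "x \<otimes> g = g \<otimes> x" if "g \<in> carrier G" for g
        using eq[OF that] that x inv_solve_right' m_closed by metis
      hence "x = \<one>" using neg x by blast
      thus False using C x one by simp
    qed
    thus ?thesis using k by simp
  qed
  have "card (carrier G) = (\<Sum>C\<in>?O. card C)"
    unfolding card_eq_sum by (rule a.disjoint_sum[OF finite_carrier, symmetric])
  also have "\<dots> = 1 + (\<Sum>C\<in>?O - {{\<one>}}. card C)"
    using sum.remove[OF finO O1, of card] by simp
  finally have e: "order G = 1 + (\<Sum>C\<in>?O - {{\<one>}}. card C)" by (simp add: order_def)
  obtain n where n: "order G = p ^ n" using p_power by blast
  hence "n \<noteq> 0" using assms by (cases n) auto
  hence "p dvd 1 + (\<Sum>C\<in>?O - {{\<one>}}. card C)" unfolding e[symmetric] using n by simp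
  moreover have "p dvd (\<Sum>C\<in>?O - {{\<one>}}. card C)" using dv by (rule dvd_sum)
  ultimately have "p dvd 1" by (rule dvd_add_left_iff[THEN iffD1, rotated])
  thus False using prime_p by simp
qed

text \<open>
  Among the normal subgroups that iterated commutation with \<open>G\<close> brings down to the identity, take
  a maximal one \<open>L\<close>. If \<open>L\<close> were proper, then the preimage of the centre of \<open>G Mod L\<close> would be a
  larger one.
\<close>
lemma lc_eventually_trivial: "\<exists>k. \<gamma> (Suc k) = {\<one>}"
proof -
  define it where "it = (\<lambda>j. (\<lambda>H. commutator_subgroup G H (carrier G)) ^^ j)"
  have mono: "it j A \<subseteq> it j B" if "A \<subseteq> B" "B \<subseteq> carrier G" for j A B
  proof -
    have "it j A \<subseteq> it j B \<and> it j B \<subseteq> carrier G"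
    proof (induction j)
      case 0 thus ?case using that by (simp add: it_def)
    next
      case (Suc j)
      let ?c = "\<lambda>Y. {cmt G h k |h k. h \<in> Y \<and> k \<in> carrier G}"
      have "?c (it j A) \<subseteq> ?c (it j B)" "?c (it j B) \<subseteq> carrier G" using Suc by auto
      thus ?case using mono_generate generate_incl
        by (simp add: it_def commutator_subgroup_alt)
    qed
    thus ?thesis by blast
  qed
  define S where "S = {L. L \<lhd> G \<and> (\<exists>j. it j L = {\<one>})}"
  have "it 0 {\<one>} = {\<one>}" by (simp add: it_def)
  hence "{\<one>} \<in> S" unfolding S_def using one_is_normal by blast
  moreover have finS: "finite S"
  proof (rule finite_subset)
    show "S \<subseteq> Pow (carrier G)" unfolding S_def using normal_imp_subgroup subgroup.subset by blast
  qed (use finite_carrier in simp)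
  ultimately obtain L where L: "L \<in> S" and mx: "\<And>K. K \<in> S \<Longrightarrow> L \<subseteq> K \<Longrightarrow> K = L"
    using finite_has_maximal[of S] by blast
  then obtain j where j: "it j L = {\<one>}" and Ln: "L \<lhd> G" unfolding S_def by blast
  interpret L: normal L G by fact
  have "L = carrier G"
  proof (rule ccontr)
    assume ne: "L \<noteq> carrier G"
    interpret Q: finite_p_group "G Mod L" p by (rule quotient_finite_p_group[OF Ln])
    have ex: "\<exists>x\<in>carrier G. x \<notin> L" using ne L.subset by blast
    have "order (G Mod L) \<noteq> 1"
    proof
      assume "order (G Mod L) = 1"
      hence "card L = order G" using lagrange[OF L.subgroup_axioms]
        by (simp add: order_def FactGroup_def)
      thus False using ne L.subset finite_carrier card_subset_eq by (metis order_def)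
    qed
    moreover have "order (G Mod L) > 0" using Q.order_gt_0_iff_finite Q.finite_carrier by simp
    ultimately have "1 < order (G Mod L)" by simp
    then obtain Z where Z: "Z \<in> carrier (G Mod L)" "Z \<noteq> \<one>\<^bsub>G Mod L\<^esub>"
      "\<And>g. g \<in> carrier (G Mod L) \<Longrightarrow> Z \<otimes>\<^bsub>G Mod L\<^esub> g = g \<otimes>\<^bsub>G Mod L\<^esub> Z"
      using Q.center_nontrivial by blast
    obtain z where z: "z \<in> carrier G" "Z = L #> z" using Z by (auto simp: carrier_FactGroup)
    have zL: "z \<notin> L" using Z(2) z coset_join2[OF z(1) L.subgroup_axioms] by auto
    have zc: "cmt G z g \<in> L" if g: "g \<in> carrier G" for g
    proof -
      have "(L #> z) <#> (L #> g) = (L #> g) <#> (L #> z)"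
        using Z(3)[of "L #> g"] g z by (auto simp: carrier_FactGroup)
      hence "L #> (z \<otimes> g) = L #> (g \<otimes> z)" using L.rcos_sum g z by simp
      hence "z \<otimes> g \<in> L #> (g \<otimes> z)"
        using rcos_self[OF _ L.subgroup_axioms, of "z \<otimes> g"] g z by simp
      hence "(z \<otimes> g) \<otimes> inv (g \<otimes> z) \<in> L" using L.rcos_module_imp[OF is_group] g z by auto
      thus ?thesis using g z by (simp add: cmt_def word_simps)
    qed
    define K where "K = {x \<in> carrier G. \<forall>g\<in>carrier G. cmt G x g \<in> L}"
    have LK: "L \<subseteq> K" unfolding K_def using cmt_mem_normal(1)[OF Ln] L.subset by blast
    have K1: "K = (\<Inter>g\<in>carrier G. {x \<in> carrier G. cmt G g x \<in> L})"
      unfolding K_def using cmt_mem_swap[OF L.subgroup_axioms] by auto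
    have Ks: "subgroup K G" unfolding K1
      by (rule subgroups_Inter) (use centralizer_mod_subgroup[OF Ln] in auto)
    have Kn: "K \<lhd> G"
    proof (rule normal_invI[OF Ks])
      fix g h assume g: "g \<in> carrier G" and h: "h \<in> K"
      have "cmt G g h \<in> L" using cmt_mem_swap[OF L.subgroup_axioms] g h K_def by blast
      hence "cmt G g h \<otimes> h \<in> K" using h LK subgroup.m_closed[OF Ks] by blast
      thus "g \<otimes> h \<otimes> inv g \<in> K"
        using conj_eq_cmt[of g h] g h by (simp add: K_def)
    qed
    have "commutator_subgroup G K (carrier G) \<subseteq> L"
      unfolding commutator_subgroup_alt
      by (rule generate_subgroup_incl[OF _ L.subgroup_axioms]) (auto simp: K_def)
    hence "it j (commutator_subgroup G K (carrier G)) \<subseteq> {\<one>}" using mono j L.subset by metis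
    hence "it (Suc j) K \<subseteq> {\<one>}" by (simp add: it_def funpow_Suc_right del: funpow.simps)
    moreover have "\<one> \<in> it (Suc j) K"
      by (simp add: it_def commutator_subgroup_alt generate.one)
    ultimately have "K \<in> S" unfolding S_def using Kn by blast
    hence "K = L" using mx LK by blast
    thus False using zc z zL K_def by blast
  qed
  thus ?thesis using j unfolding it_def lower_central_def by (auto intro!: exI[of _ j])
qed

end

section \<open>Cubes and cyclic extensions modulo a normal subgroup\<close>

context group
begin

lemma mem_subgroup_cancel:
  assumes N: "subgroup N G" and "x \<in> carrier G" "y \<in> carrier G" "x \<otimes> y \<in> N"
  shows "x \<in> N \<longleftrightarrow> y \<in> N"
proof
  assume "x \<in> N"
  hence "inv x \<otimes> (x \<otimes> y) \<in> N" using assms subgroup.m_closed subgroup.m_inv_closed by metis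
  thus "y \<in> N" using assms by (simp add: cancel_left)
next
  assume "y \<in> N"
  hence "x \<otimes> y \<otimes> inv y \<in> N" using assms subgroup.m_closed subgroup.m_inv_closed by metis
  thus "x \<in> N" using assms by (simp add: m_assoc)
qed

lemma mem_subgroup_left:
  assumes "subgroup N G" "x \<in> carrier G" "x \<otimes> y \<in> N" "y \<in> N"
  shows "x \<in> N"
  using mem_subgroup_cancel[OF assms(1,2) _ assms(3)] assms(4) subgroup.mem_carrier[OF assms(1)] by blast

lemma mem_subgroup_right:
  assumes "subgroup N G" "y \<in> carrier G" "x \<otimes> y \<in> N" "x \<in> N"
  shows "y \<in> N"
  using mem_subgroup_cancel[OF assms(1) _ assms(2,3)] assms(4) subgroup.mem_carrier[OF assms(1)] by blast

lemma cmt_cube_mod: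
  assumes N: "N \<lhd> G" and g: "g \<in> carrier G" and u: "u \<in> carrier G"
    and w: "w = cmt G g u" and v: "v = cmt G u w" and z: "z = cmt G u v"
    and vw: "cmt G v w \<in> N" and zw: "cmt G z w \<in> N" and zv: "cmt G z v \<in> N"
    and v3: "v [^] (3::nat) \<in> N"
  shows "cmt G g (u [^] (3::nat)) \<otimes> inv (w [^] (3::nat) \<otimes> z) \<in> N"
proof -
  obtain Q :: "'a set monoid" and q where "quotient_map G Q q N"
    using quotient_map_exists[OF N] by blast
  then interpret q: quotient_map G Q q N .
  have c: "w \<in> carrier G" "v \<in> carrier G" "z \<in> carrier G" using assms by auto
  have "cmt Q (q g) (q u [^]\<^bsub>Q\<^esub> (3::nat)) = q w [^]\<^bsub>Q\<^esub> (3::nat) \<otimes>\<^bsub>Q\<^esub> q v [^]\<^bsub>Q\<^esub> (3::nat) \<otimes>\<^bsub>Q\<^esub> q z"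
  proof (rule q.H.cmt_cube_right)
    show "q w = cmt Q (q g) (q u)" "q v = cmt Q (q u) (q w)" "q z = cmt Q (q u) (q v)"
      using g u c q.hom_cmt unfolding w v z by auto
  qed (use g u c q.commute_iff vw zw zv in simp_all)
  moreover have "q v [^]\<^bsub>Q\<^esub> (3::nat) = \<one>\<^bsub>Q\<^esub>"
    using v3 c q.trivial_iff[of "v [^] (3::nat)"] by (simp add: q.hom_nat_pow)
  ultimately have "q (cmt G g (u [^] (3::nat))) = q (w [^] (3::nat) \<otimes> z)"
    using g u c by (simp add: q.hom_cmt q.hom_nat_pow)
  thus ?thesis by (rule q.eq_iff[THEN iffD1, rotated 2]) (use g u c in auto)
qed

lemma cmt_cube_mod_iff:
  assumes N: "N \<lhd> G" and g: "g \<in> carrier G" and u: "u \<in> carrier G"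
    and v: "v = cmt G u (cmt G g u)" and z: "cmt G u v \<in> N"
    and vw: "cmt G v (cmt G g u) \<in> N" and v3: "v [^] (3::nat) \<in> N"
  shows "cmt G g (u [^] (3::nat)) \<in> N \<longleftrightarrow> cmt G g u [^] (3::nat) \<in> N"
proof -
  interpret N: normal N G by fact
  let ?w = "cmt G g u" and ?z = "cmt G u v"
  have c: "v \<in> carrier G" "?z \<in> carrier G" "?w \<in> carrier G" using g u v by auto
  have "cmt G g (u [^] (3::nat)) \<otimes> inv (?w [^] (3::nat) \<otimes> ?z) \<in> N"
    by (rule cmt_cube_mod[OF N g u refl v refl vw])
      (use c z cmt_mem_normal(1)[OF N z] v3 in auto)
  hence "cmt G g (u [^] (3::nat)) \<in> N \<longleftrightarrow> inv (?w [^] (3::nat) \<otimes> ?z) \<in> N"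
    by (rule mem_subgroup_cancel[OF N.subgroup_axioms, rotated 2]) (use c g u in auto)
  also have "\<dots> \<longleftrightarrow> ?w [^] (3::nat) \<otimes> ?z \<in> N"
  proof -
    have "?w [^] (3::nat) \<otimes> ?z \<in> carrier G" using c by simp
    thus ?thesis using N.m_inv_closed inv_inv by metis
  qed
  also have "\<dots> \<longleftrightarrow> ?w [^] (3::nat) \<in> N"
  proof
    assume "?w [^] (3::nat) \<otimes> ?z \<in> N"
    thus "?w [^] (3::nat) \<in> N"
      by (rule mem_subgroup_left[OF N.subgroup_axioms nat_pow_closed[OF c(3)] _ z])
  next
    assume "?w [^] (3::nat) \<in> N"
    thus "?w [^] (3::nat) \<otimes> ?z \<in> N" using z by (rule N.m_closed)
  qed
  finally show ?thesis .
qed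

text \<open>
  Each of the three exchanges of an \<open>x\<close> with a \<open>w\<close> in \<open>w x w x w x\<close> costs one factor \<open>[x,w]\<close>, and
  these factors have product 1.
\<close>
lemma cube_mult:
  assumes w: "w \<in> carrier G" and x: "x \<in> carrier G"
    and vx: "cmt G x w \<otimes> x = x \<otimes> cmt G x w" and vw: "cmt G x w \<otimes> w = w \<otimes> cmt G x w"
    and v3: "cmt G x w [^] (3::nat) = \<one>"
  shows "(w \<otimes> x) [^] (3::nat) = w [^] (3::nat) \<otimes> x [^] (3::nat)"
proof -
  define v where "v = cmt G x w"
  have c: "v \<in> carrier G" using w x v_def by simp
  have xw: "x \<otimes> w = v \<otimes> (w \<otimes> x)"
  proof -
    have "x \<otimes> w = (x \<otimes> w \<otimes> inv x) \<otimes> x" using w x by (simp add: m_assoc)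
    thus ?thesis using conj_eq_cmt[OF x w] w x by (simp add: v_def m_assoc)
  qed
  have xw': "x \<otimes> (w \<otimes> y) = v \<otimes> (w \<otimes> (x \<otimes> y))" if "y \<in> carrier G" for y
    using xw that c w x by (metis m_assoc m_closed)
  have vx': "v \<otimes> (x \<otimes> y) = x \<otimes> (v \<otimes> y)" "v \<otimes> (w \<otimes> y) = w \<otimes> (v \<otimes> y)" if "y \<in> carrier G" for y
    using vx vw that c w x v_def by (metis m_assoc)+
  have vvv: "v \<otimes> (v \<otimes> v) = \<one>" using v3 cube_eq[OF c] c v_def by (simp add: m_assoc)
  have "(w \<otimes> x) [^] (3::nat) = w \<otimes> (w \<otimes> (w \<otimes> (x \<otimes> (x \<otimes> (x \<otimes> (v \<otimes> (v \<otimes> v)))))))"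
    using c w x by (simp add: cube_eq m_assoc xw xw' vx' vx[folded v_def] vw[folded v_def])
  thus ?thesis using vvv w x by (simp add: cube_eq m_assoc)
qed

lemma cube_mult_mod:
  assumes N: "N \<lhd> G" and w: "w \<in> carrier G" and x: "x \<in> carrier G"
    and vx: "cmt G (cmt G x w) x \<in> N" and vw: "cmt G (cmt G x w) w \<in> N"
    and v3: "cmt G x w [^] (3::nat) \<in> N"
  shows "(w \<otimes> x) [^] (3::nat) \<in> N \<longleftrightarrow> w [^] (3::nat) \<otimes> x [^] (3::nat) \<in> N"
proof -
  obtain Q :: "'a set monoid" and q where "quotient_map G Q q N"
    using quotient_map_exists[OF N] by blast
  then interpret q: quotient_map G Q q N .
  have "(q w \<otimes>\<^bsub>Q\<^esub> q x) [^]\<^bsub>Q\<^esub> (3::nat) = q w [^]\<^bsub>Q\<^esub> (3::nat) \<otimes>\<^bsub>Q\<^esub> q x [^]\<^bsub>Q\<^esub> (3::nat)"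
  proof (rule q.H.cube_mult)
    show "cmt Q (q x) (q w) [^]\<^bsub>Q\<^esub> (3::nat) = \<one>\<^bsub>Q\<^esub>"
      using v3 w x q.trivial_iff[of "cmt G x w [^] (3::nat)"] by (simp add: q.hom_nat_pow q.hom_cmt)
  qed (use w x vx vw q.commute_iff[of "cmt G x w"] in \<open>simp_all add: q.hom_cmt\<close>)
  hence "q ((w \<otimes> x) [^] (3::nat)) = q (w [^] (3::nat) \<otimes> x [^] (3::nat))"
    using w x by (simp add: q.hom_nat_pow)
  thus ?thesis using w x q.trivial_iff by (metis m_closed nat_pow_closed)
qed

lemma cube_kernel_subgroup:
  assumes N: "N \<lhd> G" and A: "subgroup A G"
    and com: "\<And>x y. x \<in> A \<Longrightarrow> y \<in> A \<Longrightarrow> cmt G x y \<in> N"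
  shows "subgroup {x \<in> A. x [^] (3::nat) \<in> N} G"
proof -
  interpret N: normal N G by fact
  interpret A: subgroup A G by fact
  show ?thesis
  proof (rule subgroupI)
    show "{x \<in> A. x [^] (3::nat) \<in> N} \<noteq> {}"
    proof -
      have "\<one> \<in> {x \<in> A. x [^] (3::nat) \<in> N}" by simp
      thus ?thesis by blast
    qed
    fix x assume x: "x \<in> {x \<in> A. x [^] (3::nat) \<in> N}"
    have xc: "x \<in> carrier G" using x A.subset by blast
    show "inv x \<in> {x \<in> A. x [^] (3::nat) \<in> N}"
      using x N.m_inv_closed A.m_inv_closed nat_pow_inv[OF xc, of 3] by auto
    fix y assume y: "y \<in> {x \<in> A. x [^] (3::nat) \<in> N}"
    have yc: "y \<in> carrier G" using y A.subset by blast
    have k: "cmt G y x \<in> N" using com x y by blast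
    have "cmt G y x [^] (3::nat) \<in> N" using k N.m_closed xc yc by (simp add: cube_eq)
    hence "(x \<otimes> y) [^] (3::nat) \<in> N \<longleftrightarrow> x [^] (3::nat) \<otimes> y [^] (3::nat) \<in> N"
      using cube_mult_mod[OF N xc yc] cmt_mem_normal(1)[OF N k] xc yc by blast
    thus "x \<otimes> y \<in> {x \<in> A. x [^] (3::nat) \<in> N}" using x y A.m_closed N.m_closed by auto
  qed (use A.subset in auto)
qed

lemma generate_insert_normal:
  assumes N: "N \<lhd> G" and t: "t \<in> carrier G" and x: "x \<in> generate G (insert t N)"
  shows "\<exists>k::int. x \<otimes> t [^] k \<in> N"
proof -
  interpret N: normal N G by fact
  let ?A = "{x \<in> carrier G. \<exists>k::int. x \<otimes> t [^] k \<in> N}"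
  have "subgroup ?A G"
  proof (rule subgroupI)
    show "?A \<noteq> {}" using N.one_closed by (auto intro!: exI[of _ \<one>] exI[of _ "0::int"])
    fix a assume a: "a \<in> ?A"
    then obtain k :: int where k: "a \<otimes> t [^] k \<in> N" and ac: "a \<in> carrier G" by blast
    have p: "t [^] k \<in> carrier G" using t by simp
    have "inv a \<otimes> t [^] (- k) = t [^] k \<otimes> (inv (a \<otimes> t [^] k)) \<otimes> inv (t [^] k) "
      using ac p t by (simp add: word_simps int_pow_neg)
    hence "inv a \<otimes> t [^] (- k) \<in> N"
      using normal_conj[OF N N.m_inv_closed[OF k] p] by simp
    thus "inv a \<in> ?A" using ac by blast
    fix b assume "b \<in> ?A"
    then obtain l :: int where l: "b \<otimes> t [^] l \<in> N" and bc: "b \<in> carrier G" by blast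
    have pl: "t [^] l \<in> carrier G" using t by simp
    have "a \<otimes> b \<otimes> t [^] (l + k) = (a \<otimes> t [^] k) \<otimes> (inv (t [^] k) \<otimes> (b \<otimes> t [^] l) \<otimes> inv (inv (t [^] k)))"
      using ac bc p pl t by (simp add: word_simps int_pow_mult)
    hence "a \<otimes> b \<otimes> t [^] (l + k) \<in> N"
      using normal_conj[OF N l inv_closed[OF p]] k by simp
    thus "a \<otimes> b \<in> ?A" using ac bc by blast
  qed auto
  moreover have "insert t N \<subseteq> ?A"
  proof -
    have "t \<otimes> t [^] (-1::int) \<in> N" using t N.one_closed by (simp add: int_pow_neg)
    moreover have "n \<otimes> t [^] (0::int) \<in> N" if "n \<in> N" for n using that N.subset by auto
    ultimately show ?thesis using t N.subset by blast
  qed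
  ultimately have "generate G (insert t N) \<subseteq> ?A" by (rule generate_subgroup_incl[rotated])
  thus ?thesis using x by blast
qed

lemma generate_insert_subgroup:
  "subgroup N G \<Longrightarrow> t \<in> carrier G \<Longrightarrow> subgroup (generate G (insert t N)) G"
  using generate_is_subgroup subgroup.subset by (metis insert_subset)

lemma card_generate_insert:
  assumes fin: "finite N" and N: "N \<lhd> G" and t: "t \<in> carrier G" and p: "0 < p" "t [^] (p::nat) \<in> N"
  shows "card (generate G (insert t N)) \<le> p * card N"
proof -
  interpret N: normal N G by fact
  have "generate G (insert t N) \<subseteq> (\<Union>i\<in>{..<p}. N #> inv (t [^] i))"
  proof
    fix x assume x: "x \<in> generate G (insert t N)"
    obtain k :: int where k: "x \<otimes> t [^] k \<in> N" using generate_insert_normal[OF N t x] by blast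
    have xc: "x \<in> carrier G" using x generate_in_carrier[of "insert t N"] t N.subset by auto
    define i where "i = nat (k mod int p)"
    have i: "i < p" using p i_def by (simp add: nat_less_iff)
    have "k = int i + int p * (k div int p)" using p i_def by simp
    hence "t [^] k = t [^] (int i + int p * (k div int p))" by simp
    also have "\<dots> = t [^] i \<otimes> (t [^] p) [^] (k div int p)"
      using t by (simp add: int_pow_mult int_pow_pow int_pow_int flip: int_pow_int)
    finally have e: "t [^] k = t [^] i \<otimes> (t [^] p) [^] (k div int p)" .
    have 1: "(t [^] p) [^] (k div int p) \<in> N" by (rule subgroup_int_pow_closed[OF N.subgroup_axioms p(2)])
    have 2: "(x \<otimes> t [^] i) \<otimes> (t [^] p) [^] (k div int p) \<in> N" using k e xc t by (simp add: m_assoc)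
    have "x \<otimes> t [^] i \<in> N"
      by (rule mem_subgroup_left[OF N.subgroup_axioms _ 2 1]) (use xc t in simp)
    moreover have "x = (x \<otimes> t [^] i) \<otimes> inv (t [^] i)" using xc t by (simp add: m_assoc)
    ultimately have "x \<in> N #> inv (t [^] i)" unfolding r_coset_def by blast
    thus "x \<in> (\<Union>i\<in>{..<p}. N #> inv (t [^] i))" using i by blast
  qed
  moreover have f: "finite (N #> inv (t [^] i))" for i :: nat unfolding r_coset_def using fin by simp
  ultimately have "card (generate G (insert t N)) \<le> card (\<Union>i\<in>{..<p}. N #> inv (t [^] i))"
    by (intro card_mono) auto
  also have "\<dots> \<le> (\<Sum>i<p. card (N #> inv (t [^] i)))" by (rule card_UN_le) simp
  also have "\<dots> = (\<Sum>i<p. card N)"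
    by (intro sum.cong refl card_rcosets_equal[symmetric] rcosetsI) (use N.subset t in auto)
  finally show ?thesis by simp
qed

lemma join_normal:
  assumes "M \<lhd> G" "N \<lhd> G"
  shows "generate G (M \<union> N) \<lhd> G"
  by (rule normal_generateI)
    (use assms normal_conj[OF assms(1)] normal_conj[OF assms(2)] normal_imp_subgroup subgroup.subset in blast)+

lemma psubset_generate_insert:
  assumes "subgroup N G" "t \<in> carrier G" "t \<notin> N"
  shows "N \<subset> generate G (insert t N)"
  using assms by (auto intro: generate.incl)

lemma generate_insert_lc_normal:
  assumes "1 \<le> i" "t \<in> \<gamma> i"
  shows "generate G (insert t (\<gamma> (Suc i))) \<lhd> G"
proof (rule sandwich_normal[OF assms(1)])
  show "subgroup (generate G (insert t (\<gamma> (Suc i)))) G"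
    using generate_insert_subgroup[OF lc_subgroup] assms lc_closed by blast
  show "\<gamma> (Suc i) \<subseteq> generate G (insert t (\<gamma> (Suc i)))" by (auto intro: generate.incl)
  show "generate G (insert t (\<gamma> (Suc i))) \<subseteq> \<gamma> i"
    using generate_subgroup_incl[OF _ lc_subgroup] assms(2) lc_Suc_subset by simp
qed

lemma cyclic_trivial_derived:
  assumes x: "x \<in> carrier G" and "generate G {x} = carrier G"
  shows "\<gamma> 2 = {\<one>}"
proof -
  have "\<gamma> (Suc 1) \<subseteq> {\<one>}"
    by (rule lc_Suc_generate_least[OF _ one_is_normal, of _ "{x}" "{x}"])
      (use assms in \<open>auto simp: cmt_eq_one_iff\<close>)
  thus ?thesis using subgroup.one_closed[OF lc_subgroup] by (auto simp: numeral_2_eq_2)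
qed

lemma lc_Suc_generate:
  assumes i: "1 \<le> i" and s: "s \<in> \<gamma> i" and gen: "\<gamma> i \<subseteq> generate G (insert s (\<gamma> (Suc i)))"
    and ab: "a \<in> carrier G" "b \<in> carrier G" "generate G {a, b} = carrier G"
    and N: "N \<lhd> G" "\<gamma> (Suc (Suc i)) \<subseteq> N" "cmt G s a \<in> N" "cmt G s b \<in> N"
  shows "\<gamma> (Suc i) \<subseteq> N"
proof (rule lc_Suc_generate_least[OF i N(1) _ _ gen ab(3)])
  fix x t assume x: "x \<in> insert s (\<gamma> (Suc i))" and t: "t \<in> {a, b}"
  show "cmt G x t \<in> N" using x t N cmt_lc(1)[of "Suc i" x t] ab by auto
qed (use s lc_subset ab in auto)

lemma power_subgroup_normal: "power_subgroup G k \<lhd> G"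
  unfolding power_subgroup_def
proof (rule normal_generateI)
  fix h g assume h: "h \<in> (\<lambda>x. x [^] k) ` carrier G" and g: "g \<in> carrier G"
  then obtain x where x: "x \<in> carrier G" "h = x [^] k" by blast
  have "g \<otimes> x [^] k \<otimes> inv g = (g \<otimes> x \<otimes> inv g) [^] k" for k :: nat
  proof (induction k)
    case (Suc k)
    have "g \<otimes> x [^] Suc k \<otimes> inv g = (g \<otimes> x [^] k \<otimes> inv g) \<otimes> (g \<otimes> x \<otimes> inv g)"
      using g x by (simp add: word_simps)
    thus ?case using Suc by simp
  qed (use g in simp)
  thus "g \<otimes> h \<otimes> inv g \<in> (\<lambda>x. x [^] k) ` carrier G" using x g by auto
qed auto

end

context finite_p_group
begin

text \<open>
  By Bezout \<open>x\<close> is a power of \<open>x^k\<close>, as the order of \<open>x\<close> divides a power of \<open>p\<close>.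
\<close>
lemma coprime_power_mem:
  assumes K: "subgroup K G" and x: "x \<in> carrier G" and k: "\<not> int p dvd k" and "x [^] k \<in> K"
  shows "x \<in> K"
proof -
  obtain n where n: "order G = p ^ n" using p_power by blast
  have "coprime k (int p)" using k prime_p
    using prime_imp_coprime[of "int p" k] by (simp add: coprime_commute)
  hence "coprime k (int p ^ n)" by simp
  then obtain u v where uv: "u * k + v * int p ^ n = 1" using bezout_int[of k "int p ^ n"] by auto
  have o: "x [^] (int p ^ n) = \<one>"
    using pow_order_eq_1[OF x] n by (metis int_pow_int of_nat_power)
  have "x = x [^] (u * k + v * int p ^ n)" using uv x by simp
  also have "\<dots> = (x [^] k) [^] u \<otimes> (x [^] (int p ^ n)) [^] v"
    using x by (simp add: int_pow_mult int_pow_pow mult.commute)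
  also have "\<dots> = (x [^] k) [^] u" using o x by simp
  finally show ?thesis using subgroup_int_pow_closed[OF K assms(4), of u] by simp
qed

lemma nilpotent: "\<exists>k. \<gamma> k = {\<one>}"
  using lc_eventually_trivial by blast

lemma lc_strict:
  assumes i: "1 \<le> i" and "\<gamma> i \<subseteq> \<gamma> (Suc i)"
  shows "\<gamma> i = {\<one>}"
proof -
  obtain k where "\<gamma> k = {\<one>}" using nilpotent by blast
  hence "\<gamma> i \<subseteq> {\<one>}"
    using lc_subset_of_supplement[OF _ i one_is_normal] assms(2) by (auto intro: generate.incl)
  thus ?thesis using subgroup.one_closed[OF lc_subgroup] by blast
qed

text \<open>
  The element \<open>t\<close> bounds the index by \<open>p\<close> from above, and a proper inclusion of \<open>p\<close>-groups bounds
  it by \<open>p\<close> from below.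
\<close>
lemma card_eq_p_times:
  assumes N: "N \<lhd> G" and M: "subgroup M G" and t: "t \<in> carrier G" "t [^] p \<in> N"
    and sub: "N \<subset> M" "M \<subseteq> generate G (insert t N)"
  shows "card M = p * card N"
proof -
  have "card M \<le> card (generate G (insert t N))"
    using sub(2) finite_subgroup[OF generate_insert_subgroup[OF normal_imp_subgroup[OF N] t(1)]] card_mono by blast
  also have "\<dots> \<le> p * card N"
    using card_generate_insert[OF finite_subgroup[OF normal_imp_subgroup[OF N]] N t(1) _ t(2)] prime_gt_0_nat[OF prime_p] by blast
  finally show ?thesis using card_psubset_subgroup[OF normal_imp_subgroup[OF N] M sub(1)] by simp
qed

end

section \<open>Cubes in a 3-group whose derived subgroup has index 9\<close>

locale three_group_index_nine = finite_p_group G 3 for G (structure) +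
  assumes order_derived: "order G = 9 * card (\<gamma> 2)"
    and large: "81 \<le> order G"
begin

abbreviation "maxsub x \<equiv> generate G (insert x (\<gamma> 2))"

lemma card_lc_2_pos: "0 < card (\<gamma> 2)"
  using order_derived large by (cases "card (\<gamma> 2)") auto

text \<open>
  Otherwise \<open>G\<close> would be cyclic by nilpotency, and then of order 9.
\<close>
lemma not_cyclic_mod_derived:
  assumes x: "x \<in> carrier G"
  shows "maxsub x \<noteq> carrier G"
proof
  assume "maxsub x = carrier G"
  moreover obtain k where "\<gamma> k = {\<one>}" using nilpotent by blast
  ultimately have "generate G {x} = carrier G"
    using generate_of_generate_derived[of k "{x}"] x by simp
  hence "card (\<gamma> 2) = 1" using cyclic_trivial_derived[OF x] by simp
  thus False using order_derived large by simp
qed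

text \<open>
  If the cube of \<open>x\<close> were outside the derived subgroup, then \<open>maxsub (x^3)\<close> would lie strictly
  between it and \<open>maxsub x\<close>; an index of 9 leaves no room for that, since \<open>maxsub x\<close> is proper.
\<close>
lemma cube_in_lc_2:
  assumes x: "x \<in> carrier G"
  shows "x [^] (3::nat) \<in> \<gamma> 2"
proof (rule ccontr)
  assume n: "x [^] (3::nat) \<notin> \<gamma> 2"
  let ?A = "maxsub (x [^] (3::nat))" and ?B = "maxsub x"
  have xc: "x [^] (3::nat) \<in> carrier G" using x by simp
  have A: "subgroup ?A G" and B: "subgroup ?B G"
    using generate_insert_subgroup[OF lc_subgroup] x xc by blast+
  have "x \<notin> ?A"
  proof
    assume "x \<in> ?A"
    then obtain k :: int where "x \<otimes> (x [^] (3::nat)) [^] k \<in> \<gamma> 2"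
      using generate_insert_normal[OF lc_normal xc] by blast
    moreover have "x \<otimes> (x [^] (3::nat)) [^] k = x [^] (1 + 3 * k)"
    proof -
      have "x [^] (1 + 3 * k) = x [^] (1::int) \<otimes> x [^] (3 * k)" by (rule int_pow_mult[OF x])
      moreover have "x [^] (3 * k) = (x [^] (3::int)) [^] k" by (rule int_pow_pow[OF x, symmetric])
      moreover have "x [^] (3::int) = x [^] (3::nat)" using int_pow_int[of G x 3] by simp
      ultimately show ?thesis using x by simp
    qed
    moreover have "\<not> int 3 dvd 1 + 3 * k" by presburger
    ultimately have "x \<in> \<gamma> 2" using coprime_power_mem[OF lc_subgroup x] by metis
    thus False using n subgroup_int_pow_closed[OF lc_subgroup, of x 2 3] int_pow_int[of G x 3] by simp
  qed
  moreover have "?A \<subseteq> ?B"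
  proof (rule generate_subgroup_incl[OF _ B])
    have "x \<in> ?B" by (auto intro: generate.incl)
    hence "x [^] (3::int) \<in> ?B" by (rule subgroup_int_pow_closed[OF B])
    thus "insert (x [^] (3::nat)) (\<gamma> 2) \<subseteq> ?B"
      using int_pow_int[of G x 3] by (auto intro: generate.incl)
  qed
  moreover have "x \<in> ?B" by (auto intro: generate.incl)
  ultimately have "3 * card ?A \<le> card ?B" using card_psubset_subgroup[OF A B] by blast
  moreover have "3 * card (\<gamma> 2) \<le> card ?A"
    using card_psubset_subgroup[OF lc_subgroup A psubset_generate_insert[OF lc_subgroup xc n]] .
  ultimately have "order G \<le> card ?B" using order_derived by simp
  hence "?B = carrier G" using card_seteq[OF finite_carrier subgroup.subset[OF B]] by (simp add: order_def)
  thus False using not_cyclic_mod_derived[OF x] by blast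
qed

lemma exists_not_in_maxsub:
  assumes x: "x \<in> carrier G"
  shows "\<exists>y\<in>carrier G. y \<notin> maxsub x"
proof -
  have "maxsub x \<subseteq> carrier G"
    using generate_incl[of "insert x (\<gamma> 2)"] x lc_subset by simp
  thus ?thesis using not_cyclic_mod_derived[OF x] by blast
qed

text \<open>
  The chain from \<open>\<gamma> 2\<close> over \<open>maxsub x\<close> to the subgroup generated by \<open>x\<close>, \<open>y\<close> and \<open>\<gamma> 2\<close> is strict,
  so it exhausts the index 9; then \<open>\<gamma> 2\<close> can be dropped by nilpotency.
\<close>
lemma generate_pair:
  assumes x: "x \<in> carrier G" "x \<notin> \<gamma> 2" and y: "y \<in> carrier G" "y \<notin> maxsub x"
  shows "generate G {x, y} = carrier G"
proof -
  let ?A = "maxsub x" and ?B = "generate G ({x, y} \<union> \<gamma> 2)"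
  have s: "{x, y} \<union> \<gamma> 2 \<subseteq> carrier G" using x y lc_subset by blast
  have A: "subgroup ?A G" using generate_insert_subgroup[OF lc_subgroup] x by blast
  have B: "subgroup ?B G" using generate_is_subgroup[OF s] .
  have "?A \<subset> ?B" using mono_generate[of "insert x (\<gamma> 2)" "{x, y} \<union> \<gamma> 2"] y generate.incl[of y "{x, y} \<union> \<gamma> 2"] by auto
  hence "3 * card ?A \<le> card ?B" by (rule card_psubset_subgroup[OF A B])
  moreover have "3 * card (\<gamma> 2) \<le> card ?A"
    using card_psubset_subgroup[OF lc_subgroup A psubset_generate_insert[OF lc_subgroup x]] .
  ultimately have "order G \<le> card ?B" using order_derived by simp
  hence "?B = carrier G" using card_seteq[OF finite_carrier subgroup.subset[OF B]] by (simp add: order_def)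
  moreover obtain k where "\<gamma> k = {\<one>}" using nilpotent by blast
  ultimately show ?thesis using generate_of_generate_derived[of k "{x, y}"] x y by simp
qed

lemma card_maximal:
  assumes x: "x \<in> carrier G" "x \<notin> \<gamma> 2"
  shows "card (maxsub x) = 3 * card (\<gamma> 2)"
  using card_eq_p_times[OF lc_normal generate_insert_subgroup[OF lc_subgroup x(1)] x(1) cube_in_lc_2[OF x(1)]
      psubset_generate_insert[OF lc_subgroup x]] by simp

lemma exists_generating_pair:
  obtains a b where "a \<in> carrier G" "b \<in> carrier G" "a \<notin> \<gamma> 2" "b \<notin> maxsub a"
    "generate G {a, b} = carrier G"
proof -
  have "\<gamma> 2 \<noteq> carrier G" using order_derived card_lc_2_pos by (auto simp: order_def)
  then obtain a where a: "a \<in> carrier G" "a \<notin> \<gamma> 2" using lc_subset by blast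
  then obtain b where "b \<in> carrier G" "b \<notin> maxsub a" using exists_not_in_maxsub by blast
  thus thesis using that a generate_pair by blast
qed

lemma lc_2_generate:
  assumes a: "a \<in> carrier G" and b: "b \<in> carrier G" and g: "generate G {a, b} = carrier G"
  shows "\<gamma> 2 \<subseteq> generate G (insert (cmt G a b) (\<gamma> 3))"
proof -
  have c: "cmt G a b \<in> \<gamma> 2" using cmt_lc(1)[of 1 a b] a b by (simp add: numeral_2_eq_2)
  let ?N = "generate G (insert (cmt G a b) (\<gamma> 3))"
  have N: "?N \<lhd> G" using generate_insert_lc_normal[of 2, OF _ c] by (simp add: numeral_3_eq_3 numeral_2_eq_2)
  have 1: "cmt G a b \<in> ?N" by (auto intro: generate.incl)
  have "cmt G a a \<in> ?N" "cmt G b b \<in> ?N"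
    using cmt_eq_one_iff[of a a] cmt_eq_one_iff[of b b] a b generate.one by auto
  hence "\<gamma> (Suc 1) \<subseteq> ?N"
    by (intro lc_Suc_generate_least[OF _ N, of _ "{a, b}" "{a, b}"])
      (use a b g 1 cmt_mem_swap[OF normal_imp_subgroup[OF N] a b 1] in auto)
  thus ?thesis by (simp add: numeral_2_eq_2)
qed

text \<open>
  Modulo \<open>\<gamma> (i + 2)\<close> the cube of \<open>[g,u]\<close> is \<open>[g,u^3]\<close>, and this is trivial as \<open>u^3\<close> has already
  moved down by one step.
\<close>
lemma cube_of_lc:
  assumes "1 \<le> i" "x \<in> \<gamma> i"
  shows "x [^] (3::nat) \<in> \<gamma> (Suc i)"
  using assms
proof (induction i arbitrary: x rule: dec_induct)
  case base thus ?case using cube_in_lc_2 by (simp add: numeral_2_eq_2)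
next
  case (step i)
  let ?N = "\<gamma> (Suc (Suc i))"
  let ?T = "{x \<in> \<gamma> (Suc i). x [^] (3::nat) \<in> ?N}"
  have T: "subgroup ?T G"
    by (rule cube_kernel_subgroup[OF lc_normal lc_subgroup]) (use cmt_lc(1) lc_closed in simp)
  have "\<gamma> (Suc i) \<subseteq> ?T"
  proof (rule lc_Suc_least[OF _ T])
    show i: "1 \<le> i" using step by simp
    fix u g assume u: "u \<in> \<gamma> i" and g: "g \<in> carrier G"
    have uc: "u \<in> carrier G" using u lc_closed by blast
    have w: "cmt G g u \<in> \<gamma> (Suc i)" using cmt_lc(2)[OF i u g] .
    have v: "cmt G u (cmt G g u) \<in> ?N" using cmt_lc(2)[of "Suc i", OF _ w uc] by simp
    have vc: "cmt G u (cmt G g u) [^] (3::nat) \<in> ?N"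
      using v lc_closed subgroup.m_closed[OF lc_subgroup] by (simp add: cube_eq)
    have "u [^] (3::nat) \<in> \<gamma> (Suc i)" using step.IH u by blast
    hence "cmt G g (u [^] (3::nat)) \<in> ?N" using cmt_lc(2)[of "Suc i"] g by simp
    hence w3: "cmt G g u [^] (3::nat) \<in> ?N"
      using cmt_cube_mod_iff[OF lc_normal g uc refl _ _ vc] cmt_mem_normal[OF lc_normal v] uc g by simp
    have "cmt G u g = inv (cmt G g u)" using inv_cmt g uc by simp
    hence "cmt G u g [^] (3::nat) = inv (cmt G g u [^] (3::nat))" using g uc nat_pow_inv by simp
    thus "cmt G u g \<in> ?T" using w3 cmt_lc(1)[OF i u g] subgroup.m_inv_closed[OF lc_subgroup] by simp
  qed
  thus ?case using step.prems by blast
qed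

lemma card_lc_step:
  assumes i: "1 \<le> i" and s: "s \<in> \<gamma> i" "\<gamma> i \<subseteq> generate G (insert s (\<gamma> (Suc i)))" and nt: "\<gamma> i \<noteq> {\<one>}"
  shows "card (\<gamma> i) = 3 * card (\<gamma> (Suc i))"
proof (rule card_eq_p_times[OF lc_normal lc_subgroup lc_closed[OF s(1)] cube_of_lc[OF i s(1)] _ s(2)])
  show "\<gamma> (Suc i) \<subset> \<gamma> i" using lc_Suc_subset lc_strict[OF i] nt by blast
qed

lemma lc_2_nontrivial: "\<gamma> 2 \<noteq> {\<one>}"
  using order_derived large by auto

lemma card_lc_2: "card (\<gamma> 2) = 3 * card (\<gamma> 3)"
proof -
  obtain a b where ab: "a \<in> carrier G" "b \<in> carrier G" "generate G {a, b} = carrier G"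
    using exists_generating_pair by metis
  have "cmt G a b \<in> \<gamma> 2" using cmt_lc(1)[of 1 a b] ab by (simp add: numeral_2_eq_2)
  thus ?thesis using card_lc_step[of 2] lc_2_generate[OF ab] lc_2_nontrivial by simp
qed

lemma lc_3_nontrivial: "\<gamma> 3 \<noteq> {\<one>}"
  using order_derived large card_lc_2 by auto

lemma lc_3_not_subset: "\<not> \<gamma> 3 \<subseteq> \<gamma> 4"
  using lc_strict[of 3] lc_3_nontrivial by auto

text \<open>
  The quotient by \<open>\<gamma> 3\<close> has order 27, and exponent 9 has to be excluded. If \<open>t = x^3\<close> is not in \<open>\<gamma> 3\<close>,
  it generates \<open>\<gamma> 2\<close> modulo \<open>\<gamma> 3\<close>. The second generator can be chosen as an element \<open>z\<close> with
  \<open>z^3\<close> in \<open>\<gamma> 3\<close>. Modulo \<open>\<gamma> 4\<close> the cube formula gives \<open>[x,z]^3 = [x,z^3] = 1\<close> and so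
  \<open>[z,t] = [z,x]^3 = 1\<close>, that is, \<open>t\<close> is central modulo \<open>\<gamma> 4\<close>. Then \<open>\<gamma> 3\<close> is contained in \<open>\<gamma> 4\<close>, although
  \<open>|G| > 27\<close> makes \<open>\<gamma> 3\<close> nontrivial.
\<close>
lemma cube_in_lc_3:
  assumes "x \<in> carrier G"
  shows "x [^] (3::nat) \<in> \<gamma> 3"
proof (rule ccontr)
  assume n: "x [^] (3::nat) \<notin> \<gamma> 3"
  define t where "t = x [^] (3::nat)"
  have x: "x \<in> carrier G" by fact
  have t2: "t \<in> \<gamma> 2" using cube_in_lc_2[OF x] t_def by simp
  have t3: "t \<notin> \<gamma> 3" using n t_def by simp
  have tc: "t \<in> carrier G" using t2 lc_closed by blast
  have x2: "x \<notin> \<gamma> 2" using n cube_of_lc[of 2 x] by auto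
  obtain y where y: "y \<in> carrier G" "y \<notin> maxsub x" using exists_not_in_maxsub[OF x] by blast
  have gen: "generate G (insert t (\<gamma> 3)) = \<gamma> 2"
  proof -
    have A: "subgroup (generate G (insert t (\<gamma> 3))) G" by (rule generate_insert_subgroup[OF lc_subgroup tc])
    have "3 * card (\<gamma> 3) \<le> card (generate G (insert t (\<gamma> 3)))"
      using card_psubset_subgroup[OF lc_subgroup A psubset_generate_insert[OF lc_subgroup tc t3]] .
    moreover have "generate G (insert t (\<gamma> 3)) \<subseteq> \<gamma> 2"
      using generate_subgroup_incl[OF _ lc_subgroup] t2 lc_antimono[of 2 3] by simp
    ultimately show ?thesis using card_seteq[OF finite_subgroup[OF lc_subgroup]] card_lc_2 by simp
  qed
  have "y [^] (3::nat) \<in> generate G (insert t (\<gamma> 3))" using gen cube_in_lc_2[OF y(1)] by simp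
  then obtain k :: int where k: "y [^] (3::nat) \<otimes> t [^] k \<in> \<gamma> 3"
    using generate_insert_normal[OF lc_normal tc] by blast
  \<comment> \<open>Modulo \<gamma> 3 cubing is a homomorphism, so the cube of z is the element in the fact k.\<close>
  define z where "z = y \<otimes> x [^] k"
  have zc: "z \<in> carrier G" using x y z_def by simp
  have B: "subgroup (maxsub x) G" by (rule generate_insert_subgroup[OF lc_subgroup x])
  have zn: "z \<notin> maxsub x"
  proof
    assume z: "z \<in> maxsub x"
    have "x [^] k \<in> maxsub x"
      by (rule subgroup_int_pow_closed[OF B]) (auto intro: generate.incl)
    thus False using mem_subgroup_left[OF B y(1)] z y(2) z_def by blast
  qed
  have z3: "z [^] (3::nat) \<in> \<gamma> 3"
  proof -
    have xk: "x [^] k \<in> carrier G" using x by simp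
    have v: "cmt G (x [^] k) y \<in> \<gamma> 2" using cmt_lc(1)[of 1 "x [^] k" y] xk y by (simp add: numeral_2_eq_2)
    have "(x [^] k) [^] (3::nat) = (x [^] k) [^] (3::int)" using int_pow_int[of G "x [^] k" 3] by simp
    also have "\<dots> = (x [^] (3::int)) [^] k" using x by (simp add: int_pow_pow mult.commute)
    also have "\<dots> = t [^] k" using t_def int_pow_int[of G x 3] by simp
    finally have e: "(x [^] k) [^] (3::nat) = t [^] k" .
    have "cmt G (cmt G (x [^] k) y) u \<in> \<gamma> 3" if "u \<in> carrier G" for u
      using cmt_lc(1)[OF _ v that] by (simp add: numeral_3_eq_3)
    moreover have "cmt G (x [^] k) y [^] (3::nat) \<in> \<gamma> 3" using cube_of_lc[OF _ v] by (simp add: numeral_3_eq_3)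
    ultimately show ?thesis
      unfolding z_def using cube_mult_mod[OF lc_normal y(1) xk] xk y k e by simp
  qed
  have gen2: "generate G {x, z} = carrier G" by (rule generate_pair[OF x x2 zc zn])
  have 4: "\<gamma> (Suc 3) = \<gamma> 4" "\<gamma> (Suc 2) = \<gamma> 3" by simp_all
  \<comment> \<open>Modulo \<gamma> 4 the correction terms of the cube formula vanish for all pairs of elements.\<close>
  have key: "cmt G p (q [^] (3::nat)) \<in> \<gamma> 4 \<longleftrightarrow> cmt G p q [^] (3::nat) \<in> \<gamma> 4"
    if p: "p \<in> carrier G" and q: "q \<in> carrier G" for p q
  proof -
    have w: "cmt G p q \<in> \<gamma> 2" using cmt_lc(1)[of 1 p q] that by (simp add: numeral_2_eq_2)
    have v: "cmt G q (cmt G p q) \<in> \<gamma> 3" using cmt_lc(2)[OF _ w q] 4 by simp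
    show ?thesis
      by (rule cmt_cube_mod_iff[OF lc_normal p q refl])
        (use cmt_lc[OF _ v] cube_of_lc[OF _ v] 4 p q in auto)
  qed
  have "cmt G x (z [^] (3::nat)) \<in> \<gamma> 4" using cmt_lc(2)[OF _ z3 x] 4 by simp
  hence w3: "cmt G x z [^] (3::nat) \<in> \<gamma> 4" using key[OF x zc] by simp
  have "cmt G z x [^] (3::nat) = inv (cmt G x z [^] (3::nat))"
    using inv_cmt[OF x zc] x zc nat_pow_inv by (metis cmt_closed)
  hence "cmt G z x [^] (3::nat) \<in> \<gamma> 4" using w3 subgroup.m_inv_closed[OF lc_subgroup] by simp
  hence "cmt G z t \<in> \<gamma> 4" using key[OF zc x] t_def by simp
  hence tz: "cmt G t z \<in> \<gamma> 4" using cmt_mem_swap[OF lc_subgroup zc tc] by simp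
  have "t \<otimes> x = x \<otimes> t" unfolding t_def using x by (simp add: cube_eq m_assoc)
  hence tx: "cmt G t x \<in> \<gamma> 4" using cmt_eq_one_iff[OF tc x] subgroup.one_closed[OF lc_subgroup] by simp
  have "\<gamma> (Suc 2) \<subseteq> \<gamma> 4"
    by (rule lc_Suc_generate[OF _ t2 _ x zc gen2 lc_normal]) (use 4 gen tx tz in auto)
  thus False using lc_3_not_subset 4 by simp
qed

text \<open>
  The quotient by the cubes is 2-Engel, so modulo the cubes the commutator of two generators
  commutes with both of them.
\<close>
lemma lc_3_subset_cubes: "\<gamma> 3 \<subseteq> power_subgroup G 3"
proof -
  let ?P = "power_subgroup G 3"
  have P: "?P \<lhd> G" by (rule power_subgroup_normal)
  have cubes: "x [^] (3::nat) \<in> ?P" if "x \<in> carrier G" for x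
    unfolding power_subgroup_def using that by (auto intro: generate.incl)
  have engel: "cmt G w (cmt G w x) \<in> ?P" if w: "w \<in> carrier G" and x: "x \<in> carrier G" for w x
  proof -
    obtain Q :: "'a set monoid" and q where "quotient_map G Q q ?P"
      using quotient_map_exists[OF P] by blast
    then interpret q: quotient_map G Q q ?P .
    have "y [^]\<^bsub>Q\<^esub> (3::nat) = \<one>\<^bsub>Q\<^esub>" if y: "y \<in> carrier Q" for y
    proof -
      obtain u where u: "u \<in> carrier G" "y = q u"
        using y unfolding q.onto[symmetric] by auto
      thus ?thesis using q.trivial_iff[of "u [^] (3::nat)"] cubes by (simp add: q.hom_nat_pow)
    qed
    hence "cmt Q (q w) (cmt Q (q w) (q x)) = \<one>\<^bsub>Q\<^esub>"
      using q.H.exponent_three_engel w x by simp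
    hence "q (cmt G w (cmt G w x)) = \<one>\<^bsub>Q\<^esub>" using w x by (simp add: q.hom_cmt)
    thus ?thesis using q.trivial_iff w x by simp
  qed
  obtain a b where ab: "a \<in> carrier G" "b \<in> carrier G" "generate G {a, b} = carrier G"
    using exists_generating_pair by metis
  define c where "c = cmt G a b"
  have c2: "c \<in> \<gamma> 2" using cmt_lc(1)[of 1 a b] ab by (simp add: numeral_2_eq_2 c_def)
  have cc: "c \<in> carrier G" using c2 lc_closed by blast
  let ?N = "generate G (?P \<union> \<gamma> 4)"
  have N: "?N \<lhd> G" by (rule join_normal[OF P lc_normal])
  have sub: "?P \<subseteq> ?N" "\<gamma> 4 \<subseteq> ?N" by (auto intro: generate.incl)
  have "cmt G a c \<in> ?P" using engel ab c_def by simp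
  hence 1: "cmt G c a \<in> ?N" using cmt_mem_swap[OF normal_imp_subgroup[OF P] ab(1) cc] sub by blast
  have "cmt G b (inv c) \<in> ?P" using engel[OF ab(2,1)] inv_cmt[OF ab(1,2)] c_def by simp
  hence "inv c \<in> {g \<in> carrier G. cmt G b g \<in> ?P}" using cc by simp
  hence "inv (inv c) \<in> {g \<in> carrier G. cmt G b g \<in> ?P}"
    by (rule subgroup.m_inv_closed[OF centralizer_mod_subgroup[OF P ab(2)]])
  hence "cmt G b c \<in> ?P" using cc by simp
  hence 2: "cmt G c b \<in> ?N" using cmt_mem_swap[OF normal_imp_subgroup[OF P] ab(2) cc] sub by blast
  have "\<gamma> (Suc 2) \<subseteq> ?N"
    by (rule lc_Suc_generate[OF _ c2 _ ab N _ 1 2])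
      (use lc_2_generate[OF ab] sub in \<open>auto simp: c_def\<close>)
  moreover obtain k where "\<gamma> k = {\<one>}" using nilpotent by blast
  ultimately show ?thesis using lc_subset_of_supplement[of k 3, OF _ _ P] by simp
qed

lemma cubes_eq_lc_3: "power_subgroup G 3 = \<gamma> 3"
proof
  show "power_subgroup G 3 \<subseteq> \<gamma> 3"
    unfolding power_subgroup_def
    by (rule generate_subgroup_incl[OF _ lc_subgroup]) (use cube_in_lc_3 in auto)
qed (rule lc_3_subset_cubes)

lemma index_lc_3: "subgroup_index G (\<gamma> 3) = 27"
proof -
  have "subgroup_index G (\<gamma> 3) * card (\<gamma> 3) = 27 * card (\<gamma> 3)"
    unfolding subgroup_index_def using lagrange[OF lc_subgroup, of 3] order_derived card_lc_2 by simp
  moreover have "card (\<gamma> 3) \<noteq> 0" using card_lc_2_pos card_lc_2 by simp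
  ultimately show ?thesis by simp
qed

end

section \<open>Maximal subgroups\<close>

context group
begin

lemma cmt_in_derived:
  "x \<in> H \<Longrightarrow> y \<in> H \<Longrightarrow> cmt G x y \<in> derived G H"
  unfolding derived_def cmt_def by (rule generate.incl) auto

lemma derived_least:
  assumes "subgroup N G" "\<And>x y. x \<in> H \<Longrightarrow> y \<in> H \<Longrightarrow> cmt G x y \<in> N"
  shows "derived G H \<subseteq> N"
  unfolding derived_def by (rule generate_subgroup_incl[OF _ assms(1)]) (use assms(2) in \<open>auto simp: cmt_def\<close>)

lemma normal_generate_of_generators:
  assumes U: "U \<subseteq> carrier G" and S: "S \<subseteq> carrier G" "generate G S = carrier G"
    and n: "\<And>s u. s \<in> S \<Longrightarrow> u \<in> U \<Longrightarrow> s \<otimes> u \<otimes> inv s \<in> generate G U"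
    and n': "\<And>s u. s \<in> S \<Longrightarrow> u \<in> U \<Longrightarrow> inv s \<otimes> u \<otimes> s \<in> generate G U"
  shows "generate G U \<lhd> G"
proof (rule normal_of_generators[OF generate_is_subgroup[OF U] S])
  have T: "subgroup (generate G U) G" by (rule generate_is_subgroup[OF U])
  interpret T: subgroup "generate G U" G by fact
  have conj: "g \<otimes> t \<otimes> inv g \<in> generate G U"
    if g: "g \<in> carrier G" and u: "\<And>u. u \<in> U \<Longrightarrow> g \<otimes> u \<otimes> inv g \<in> generate G U" and t: "t \<in> generate G U"
    for g t
    using t
  proof (induction t rule: generate.induct)
    case (inv h)
    have "g \<otimes> inv h \<otimes> inv g = inv (g \<otimes> h \<otimes> inv g)" using g inv U by (auto simp: word_simps)
    thus ?case using T.m_inv_closed[OF u[OF inv]] by simp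
  next
    case (eng h k)
    have c: "h \<in> carrier G" "k \<in> carrier G" using eng T.subset by auto
    have "g \<otimes> (h \<otimes> k) \<otimes> inv g = (g \<otimes> h \<otimes> inv g) \<otimes> (g \<otimes> k \<otimes> inv g)"
      using g c by (simp add: word_simps)
    thus ?case using T.m_closed[OF eng.IH] by simp
  qed (use g u in auto)
  fix s t assume s: "s \<in> S" and t: "t \<in> generate G U"
  have sc: "s \<in> carrier G" using s S by blast
  show "s \<otimes> t \<otimes> inv s \<in> generate G U" using conj[OF sc n[OF s] t] .
  have "inv s \<otimes> u \<otimes> inv (inv s) \<in> generate G U" if "u \<in> U" for u using n'[OF s that] sc by simp
  thus "inv s \<otimes> t \<otimes> s \<in> generate G U" using conj[OF inv_closed[OF sc] _ t] sc by simp
qed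

end

context three_group_index_nine
begin

lemma maxsub_subgroup: "x \<in> carrier G \<Longrightarrow> subgroup (maxsub x) G"
  by (rule generate_insert_subgroup[OF lc_subgroup])

lemma maxsub_maximal:
  assumes x: "x \<in> carrier G" "x \<notin> \<gamma> 2"
  shows "maximal_subgroup (maxsub x) G"
  unfolding maximal_subgroup_def
proof (intro conjI allI impI)
  show H: "subgroup (maxsub x) G" using maxsub_subgroup x by blast
  show "maxsub x \<noteq> carrier G" using not_cyclic_mod_derived x by blast
  fix K assume K: "subgroup K G \<and> maxsub x \<subseteq> K"
  show "K = maxsub x \<or> K = carrier G"
  proof (rule ccontr)
    assume n: "\<not> ?thesis"
    have "3 * card (maxsub x) \<le> card K" using card_psubset_subgroup[OF H, of K] K n by blast
    hence "order G \<le> card K" using card_maximal[OF x] order_derived by simp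
    thus False using n K card_seteq[OF finite_carrier, of K] subgroup.subset[of K G] by (auto simp: order_def)
  qed
qed

text \<open>
  A maximal subgroup contains the derived subgroup by nilpotency, and it is not the derived subgroup
  because \<open>G Mod \<gamma> 2\<close> is not cyclic; any further element determines it.
\<close>
lemma maximal_subgroup_eq_maxsub:
  assumes H: "maximal_subgroup H G"
  obtains x where "x \<in> carrier G" "x \<notin> \<gamma> 2" "H = maxsub x"
proof -
  have Hs: "subgroup H G" and Hn: "H \<noteq> carrier G"
    and mx: "\<And>K. subgroup K G \<Longrightarrow> H \<subseteq> K \<Longrightarrow> K = H \<or> K = carrier G"
    using H unfolding maximal_subgroup_def by auto
  have Hc: "H \<subseteq> carrier G" using subgroup.subset[OF Hs] .
  let ?K = "generate G (H \<union> \<gamma> 2)"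
  have "subgroup ?K G" "H \<subseteq> ?K" "\<gamma> 2 \<subseteq> ?K"
    using generate_is_subgroup[of "H \<union> \<gamma> 2"] Hc lc_subset by (auto intro: generate.incl)
  moreover have "?K \<noteq> carrier G"
  proof
    assume "?K = carrier G"
    moreover obtain k where "\<gamma> k = {\<one>}" using nilpotent by blast
    ultimately have "generate G H = carrier G" using generate_of_generate_derived Hc by blast
    moreover have "generate G H \<subseteq> H" by (rule generate_subgroup_incl[OF subset_refl Hs])
    ultimately show False using Hc Hn by blast
  qed
  ultimately have sub: "\<gamma> 2 \<subseteq> H" using mx by blast
  have "\<gamma> 2 \<noteq> H"
  proof
    assume e: "\<gamma> 2 = H"
    obtain a where a: "a \<in> carrier G" "a \<notin> \<gamma> 2" using exists_generating_pair by metis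
    have "\<gamma> 2 \<subset> maxsub a" by (rule psubset_generate_insert[OF lc_subgroup a])
    thus False using mx[OF maxsub_subgroup[OF a(1)]] not_cyclic_mod_derived[OF a(1)] e by blast
  qed
  then obtain x where x: "x \<in> H" "x \<notin> \<gamma> 2" using sub by blast
  hence xc: "x \<in> carrier G" using Hc by blast
  have "maxsub x \<subseteq> H" using generate_subgroup_incl[OF _ Hs] x sub by simp
  hence "H = maxsub x"
    using maxsub_maximal[OF xc x(2)] Hs Hn unfolding maximal_subgroup_def by blast
  thus thesis using that xc x(2) by blast
qed

lemma lc_2_maxsub: "\<gamma> 2 \<subseteq> maxsub x" "x \<in> maxsub x"
  by (auto intro: generate.incl)

lemma maxsub_normal:
  assumes "x \<in> carrier G"
  shows "maxsub x \<lhd> G"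
  using generate_insert_lc_normal[of 1 x] assms by (simp add: numeral_2_eq_2)

text \<open>
  With a second generator \<open>g\<close> of \<open>G\<close>, the three generators are \<open>x\<close> and its conjugates by \<open>g\<close> and
  \<open>g^2\<close>. As \<open>g^3\<close> lies in \<open>maxsub x\<close>, conjugation by \<open>g\<close> permutes these elements cyclically modulo
  the derived subgroup \<open>D\<close> of \<open>maxsub x\<close>. Hence together with \<open>D\<close> they generate a normal subgroup \<open>T\<close>
  of \<open>G\<close>, and \<open>G Mod T\<close> is generated by the image of \<open>g\<close>. So \<open>T\<close> contains \<open>\<gamma> 2\<close> and is \<open>maxsub x\<close>;
  finally \<open>D\<close> is superfluous because \<open>maxsub x\<close> is nilpotent.
\<close>
lemma maxsub_three_generated:
  assumes x: "x \<in> carrier G" "x \<notin> \<gamma> 2"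
  shows "\<exists>S\<subseteq>maxsub x. finite S \<and> card S \<le> 3 \<and> generate G S = maxsub x"
proof -
  let ?H = "maxsub x"
  have H: "?H \<lhd> G" by (rule maxsub_normal[OF x(1)])
  have Hs: "subgroup ?H G" by (rule normal_imp_subgroup[OF H])
  interpret Hs: subgroup ?H G by fact
  obtain g where g: "g \<in> carrier G" "g \<notin> ?H" using exists_not_in_maxsub[OF x(1)] by blast
  have gen: "generate G {x, g} = carrier G" by (rule generate_pair[OF x g])
  let ?D = "derived G ?H"
  have D: "?D \<lhd> G" by (rule derived_is_normal[OF H])
  interpret D: normal ?D G by fact
  have DH: "?D \<subseteq> ?H"
    by (rule derived_least[OF Hs]) (use Hs.m_closed Hs.m_inv_closed in \<open>auto simp: cmt_def\<close>)
  define x1 where "x1 = g \<otimes> x \<otimes> inv g"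
  define x2 where "x2 = g \<otimes> x1 \<otimes> inv g"
  have xH: "x \<in> ?H" "x1 \<in> ?H" "x2 \<in> ?H"
    using normal_conj[OF H _ g(1)] lc_2_maxsub(2)[of x] x1_def x2_def by auto
  have xc: "x1 \<in> carrier G" "x2 \<in> carrier G" using x g x1_def x2_def by auto
  let ?S = "{x, x1, x2}"
  let ?U = "?S \<union> ?D"
  let ?T = "generate G ?U"
  have Uc: "?U \<subseteq> carrier G" using x xc D.subset by auto
  interpret T: subgroup ?T G by (rule generate_is_subgroup[OF Uc])
  have UT: "?U \<subseteq> ?T" by (auto intro: generate.incl)
  define h where "h = g [^] (3::nat)"
  have h: "h \<in> ?H" "h \<in> carrier G" unfolding h_def using cube_in_lc_2[OF g(1)] lc_2_maxsub(1)[of x] g(1) by auto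
  \<comment> \<open>The cycle of conjugates closes up modulo D because g^3 acts trivially on maxsub x modulo D.\<close>
  have up: "g \<otimes> x2 \<otimes> inv g \<in> ?T"
  proof -
    have "g \<otimes> x2 \<otimes> inv g = h \<otimes> x \<otimes> inv h"
      unfolding x2_def x1_def h_def using g x by (simp add: cube_eq word_simps)
    also have "\<dots> = cmt G h x \<otimes> x" by (rule conj_eq_cmt[OF h(2) x(1)])
    finally show ?thesis using cmt_in_derived[OF h(1) xH(1)] UT T.m_closed by auto
  qed
  have down: "inv g \<otimes> x \<otimes> g \<in> ?T"
  proof -
    have ih: "inv h \<in> ?H" "inv h \<in> carrier G" using h Hs.m_inv_closed by auto
    have "inv g \<otimes> x \<otimes> g = inv h \<otimes> x2 \<otimes> inv (inv h)"
      unfolding x2_def x1_def h_def using g x by (simp add: cube_eq word_simps)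
    also have "\<dots> = cmt G (inv h) x2 \<otimes> x2" by (rule conj_eq_cmt[OF ih(2) xc(2)])
    finally show ?thesis using cmt_in_derived[OF ih(1) xH(3)] UT T.m_closed by auto
  qed
  have conjD: "s \<otimes> u \<otimes> inv s \<in> ?T" "inv s \<otimes> u \<otimes> s \<in> ?T" if "s \<in> carrier G" "u \<in> ?D" for s u
    using normal_conj[OF D that(2,1)] normal_conj[OF D that(2) inv_closed[OF that(1)]] that UT by auto
  have T: "?T \<lhd> G"
  proof (rule normal_generate_of_generators[OF Uc _ gen])
    show "{x, g} \<subseteq> carrier G" using x g by simp
    fix s u assume s: "s \<in> {x, g}" and u: "u \<in> ?U"
    have gx: "g \<otimes> u \<otimes> inv g \<in> ?T \<and> inv g \<otimes> u \<otimes> g \<in> ?T" if uS: "u \<in> ?S"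
    proof -
      have e: "inv g \<otimes> x1 \<otimes> g = x" "inv g \<otimes> x2 \<otimes> g = x1"
        unfolding x1_def x2_def using g x by (simp_all add: word_simps)
      show ?thesis using uS up down e UT x1_def x2_def by auto
    qed
    have xT: "x \<in> ?T" "inv x \<in> ?T" using UT T.m_inv_closed by auto
    have uT: "u \<in> ?T" using u UT by blast
    show "s \<otimes> u \<otimes> inv s \<in> ?T"
    proof (cases "s = x")
      case True thus ?thesis using xT uT T.m_closed by simp
    next
      case False thus ?thesis using s u gx conjD(1)[OF g(1), of u] by blast
    qed
    show "inv s \<otimes> u \<otimes> s \<in> ?T"
    proof (cases "s = x")
      case True thus ?thesis using xT uT T.m_closed by simp
    next
      case False thus ?thesis using s u gx conjD(2)[OF g(1), of u] by blast
    qed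
  qed
  have cT: "cmt G s t \<in> ?T" if "s \<in> {x, g}" "t \<in> {x, g}" for s t
  proof -
    have "x \<in> ?T" using UT by blast
    moreover have "cmt G g g \<in> ?T" using cmt_eq_one_iff[OF g(1) g(1)] T.one_closed by simp
    ultimately show ?thesis using that cmt_mem_normal[OF T] g x by auto
  qed
  have "\<gamma> (Suc 1) \<subseteq> ?T"
    by (rule lc_Suc_generate_least[OF _ T, of _ "{x, g}" "{x, g}"]) (use x g gen cT in auto)
  hence "insert x (\<gamma> 2) \<subseteq> ?T" using UT by (simp add: numeral_2_eq_2)
  hence "?H \<subseteq> ?T" by (rule generate_subgroup_incl[OF _ T.subgroup_axioms])
  moreover have UH: "?U \<subseteq> ?H" using xH DH by blast
  hence "?T \<subseteq> ?H" by (rule generate_subgroup_incl[OF _ Hs])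
  ultimately have TH: "?T = ?H" by blast
  let ?GH = "G\<lparr>carrier := ?H\<rparr>"
  interpret GH: finite_p_group ?GH 3 by (rule subgroup_finite_p_group[OF Hs])
  have "lower_central ?GH 2 = ?D"
    using lower_central_2[of ?GH] derived_consistent[OF subset_refl Hs] by simp
  hence "generate ?GH (?S \<union> lower_central ?GH 2) = carrier ?GH"
    using generate_consistent[OF UH Hs] TH by simp
  moreover obtain k where "lower_central ?GH k = {\<one>\<^bsub>?GH\<^esub>}" using GH.nilpotent by blast
  ultimately have "generate ?GH ?S = carrier ?GH"
    using GH.generate_of_generate_derived[of k ?S] xH by simp
  hence "generate G ?S = ?H" using generate_consistent[of ?S, OF _ Hs] xH by simp
  moreover have "card ?S \<le> 3" using card_length[of "[x, x1, x2]"] by simp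
  ultimately show ?thesis using xH by (intro exI[of _ ?S]) simp
qed

section \<open>A maximal subgroup with small abelianization\<close>

lemma lc_2_generator:
  assumes "a \<in> carrier G" "b \<in> carrier G" "generate G {a, b} = carrier G"
  shows "cmt G a b \<in> \<gamma> 2" "\<gamma> 2 \<subseteq> generate G (insert (cmt G a b) (\<gamma> (Suc 2)))"
  using cmt_lc(1)[of 1 a b] lc_2_generate[OF assms] assms by (simp_all add: numeral_2_eq_2 numeral_3_eq_3)

text \<open>
  The factor \<open>\<gamma> i / \<gamma> (i + 2)\<close> is abelian, so its elements of order dividing 3 form a subgroup.
\<close>
lemma exponent_two_steps:
  assumes i: "2 \<le> i" and s: "s \<in> \<gamma> i" "\<gamma> i \<subseteq> generate G (insert s (\<gamma> (Suc i)))"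
    and s3: "s [^] (3::nat) \<in> \<gamma> (Suc (Suc i))" and x: "x \<in> \<gamma> i"
  shows "x [^] (3::nat) \<in> \<gamma> (Suc (Suc i))"
proof -
  let ?T = "{x \<in> \<gamma> i. x [^] (3::nat) \<in> \<gamma> (Suc (Suc i))}"
  have T: "subgroup ?T G"
    by (rule cube_kernel_subgroup[OF lc_normal lc_subgroup])
      (use cmt_lc_derived(1)[of i] i lc_antimono[OF i] in auto)
  have "generate G (insert s (\<gamma> (Suc i))) \<subseteq> ?T"
    by (rule generate_subgroup_incl[OF _ T]) (use s s3 cube_of_lc[of "Suc i"] lc_Suc_subset[of i] in auto)
  thus ?thesis using s x by blast
qed

text \<open>
  Modulo \<open>\<gamma> 4\<close> the cube of \<open>[a,b]\<close> is \<open>[a,b^3]\<close>, and \<open>b^3\<close> is in \<open>\<gamma> 3\<close>.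
\<close>
lemma cube_of_lc_2:
  assumes "x \<in> \<gamma> 2"
  shows "x [^] (3::nat) \<in> \<gamma> 4"
proof -
  obtain a b where ab: "a \<in> carrier G" "b \<in> carrier G" "generate G {a, b} = carrier G"
    using exists_generating_pair by metis
  have 4: "\<gamma> (Suc 3) = \<gamma> 4" "\<gamma> (Suc 2) = \<gamma> 3" "\<gamma> (Suc (Suc 2)) = \<gamma> 4" by simp_all
  note w = lc_2_generator[OF ab]
  have v: "cmt G b (cmt G a b) \<in> \<gamma> 3" using cmt_lc(2)[OF _ w(1) ab(2)] 4 by simp
  have "cmt G a (b [^] (3::nat)) \<in> \<gamma> 4"
    using cmt_lc(2)[OF _ cube_in_lc_3[OF ab(2)] ab(1)] 4 by simp
  moreover have "cmt G a (b [^] (3::nat)) \<in> \<gamma> 4 \<longleftrightarrow> cmt G a b [^] (3::nat) \<in> \<gamma> 4"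
    by (rule cmt_cube_mod_iff[OF lc_normal ab(1,2) refl])
      (use cmt_lc[OF _ v] cube_of_lc[OF _ v] 4 ab in auto)
  ultimately have "cmt G a b [^] (3::nat) \<in> \<gamma> (Suc (Suc 2))" by simp
  thus ?thesis using exponent_two_steps[OF _ w _ assms] by simp
qed

text \<open>
  Since \<open>\<gamma> 2 / \<gamma> 3\<close> is cyclic, all commutators come from those of \<open>\<gamma> 2\<close> with \<open>\<gamma> 3\<close>; this is one step
  deeper than expected.
\<close>
lemma cmt_lc_2_lc_2:
  assumes "x \<in> \<gamma> 2" "y \<in> \<gamma> 2"
  shows "cmt G x y \<in> \<gamma> 5"
proof -
  obtain a b where ab: "a \<in> carrier G" "b \<in> carrier G" "generate G {a, b} = carrier G"
    using exists_generating_pair by metis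
  note w = lc_2_generator[OF ab]
  let ?S = "insert (cmt G a b) (\<gamma> (Suc 2))"
  have S2: "?S \<subseteq> \<gamma> 2" using w(1) lc_Suc_subset[of 2] by blast
  have S: "?S \<subseteq> carrier G" using S2 lc_subset by blast
  have 5: "\<gamma> (Suc (Suc (Suc 2))) = \<gamma> 5" by (simp add: eval_nat_numeral)
  have "cmt G s t \<in> \<gamma> 5" if s: "s \<in> ?S" and t: "t \<in> ?S" for s t
  proof (cases "s \<in> \<gamma> (Suc 2) \<or> t \<in> \<gamma> (Suc 2)")
    case True
    thus ?thesis
      using cmt_lc_derived(1)[of "Suc 2" s t] cmt_lc_derived(2)[of "Suc 2" t s] s t S2 5 by auto
  next
    case False
    hence "s = t" "s \<in> carrier G" using s t S by auto
    thus ?thesis using cmt_eq_one_iff[of s s] subgroup.one_closed[OF lc_subgroup] by simp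
  qed
  thus ?thesis using cmt_mem_generate[OF lc_normal S S] assms w(2) by blast
qed

text \<open>
  The Jacobi identity modulo \<open>\<gamma> 5\<close>: the third term \<open>[[b,a],w]\<close> vanishes because both entries
  are in \<open>\<gamma> 2\<close>.
\<close>
lemma cmt_swap_mod:
  assumes N: "N \<lhd> G" "\<gamma> 5 \<subseteq> N" and a: "a \<in> carrier G" and b: "b \<in> carrier G" and w: "w \<in> \<gamma> 2"
  shows "cmt G a (cmt G b w) \<in> N \<longleftrightarrow> cmt G b (cmt G a w) \<in> N"
proof -
  obtain Q :: "'a set monoid" and q where "quotient_map G Q q N"
    using quotient_map_exists[OF N(1)] by blast
  then interpret q: quotient_map G Q q N .
  have s: "\<gamma> (Suc 2) = \<gamma> 3" "\<gamma> (Suc 3) = \<gamma> 4" "\<gamma> (Suc 4) = \<gamma> 5" "\<gamma> (Suc (Suc 3)) = \<gamma> 5" by simp_all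
  have wc: "w \<in> carrier G" using w lc_closed by blast
  have 3: "cmt G a w \<in> \<gamma> 3" "cmt G b w \<in> \<gamma> 3" using cmt_lc(2)[OF _ w] a b s by simp_all
  have 2: "cmt G b a \<in> \<gamma> 2" using cmt_lc(1)[of 1 b a] a b by (simp add: numeral_2_eq_2)
  have 4: "cmt G a (cmt G b w) \<in> \<gamma> 4" using cmt_lc(2)[OF _ 3(2) a] s by simp
  have com: "q x \<otimes>\<^bsub>Q\<^esub> q y = q y \<otimes>\<^bsub>Q\<^esub> q x" if "x \<in> carrier G" "y \<in> carrier G" "cmt G x y \<in> \<gamma> 5" for x y
    using q.commute_iff[OF that(1,2)] that(3) N(2) by blast
  have com2: "q x \<otimes>\<^bsub>Q\<^esub> q y = q y \<otimes>\<^bsub>Q\<^esub> q x" if "x \<in> \<gamma> 2" "y \<in> \<gamma> 2" for x y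
    by (rule com[OF lc_closed[OF that(1)] lc_closed[OF that(2)] cmt_lc_2_lc_2[OF that]])
  have sub: "\<gamma> 3 \<subseteq> \<gamma> 2" using lc_antimono[of 2 3] by simp
  have "cmt Q (q a) (cmt Q (q b) (q w)) = cmt Q (q b) (cmt Q (q a) (q w))"
  proof (rule q.H.cmt_cmt_commute)
    show "q (cmt G a w) = cmt Q (q a) (q w)" "q (cmt G b w) = cmt Q (q b) (q w)"
      "q (cmt G b a) = cmt Q (q b) (q a)" using a b wc q.hom_cmt by auto
    show "q (cmt G a w) \<otimes>\<^bsub>Q\<^esub> q (cmt G b w) = q (cmt G b w) \<otimes>\<^bsub>Q\<^esub> q (cmt G a w)"
      by (rule com2) (use 3 sub in auto)
    show "q (cmt G b a) \<otimes>\<^bsub>Q\<^esub> q w = q w \<otimes>\<^bsub>Q\<^esub> q (cmt G b a)"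
      by (rule com2[OF 2 w])
    show "q (cmt G b a) \<otimes>\<^bsub>Q\<^esub> q (cmt G a w) = q (cmt G a w) \<otimes>\<^bsub>Q\<^esub> q (cmt G b a)"
      "q (cmt G b a) \<otimes>\<^bsub>Q\<^esub> q (cmt G b w) = q (cmt G b w) \<otimes>\<^bsub>Q\<^esub> q (cmt G b a)"
      using com2[OF 2, of "cmt G a w"] com2[OF 2, of "cmt G b w"] 3 sub by blast+
    have "q (cmt G b a) \<otimes>\<^bsub>Q\<^esub> q (cmt G a (cmt G b w)) = q (cmt G a (cmt G b w)) \<otimes>\<^bsub>Q\<^esub> q (cmt G b a)"
      by (rule com) (use cmt_lc(2)[OF _ 4] s a b wc in simp_all)
    thus "q (cmt G b a) \<otimes>\<^bsub>Q\<^esub> cmt Q (q a) (q (cmt G b w)) = cmt Q (q a) (q (cmt G b w)) \<otimes>\<^bsub>Q\<^esub> q (cmt G b a)"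
      using q.hom_cmt[OF a, of "cmt G b w"] b wc by simp
  qed (use a b wc in simp_all)
  hence "q (cmt G a (cmt G b w)) = q (cmt G b (cmt G a w))" using a b wc by (simp add: q.hom_cmt)
  thus ?thesis
    using q.trivial_iff[of "cmt G a (cmt G b w)"] q.trivial_iff[of "cmt G b (cmt G a w)"] a b wc by simp
qed

lemma lc_3_generate:
  assumes c: "c \<in> \<gamma> 2" "\<gamma> 2 \<subseteq> generate G (insert c (\<gamma> (Suc 2)))"
    and ab: "a \<in> carrier G" "b \<in> carrier G" "generate G {a, b} = carrier G"
  shows "\<gamma> 3 \<subseteq> generate G ({cmt G a c, cmt G b c} \<union> \<gamma> 4)"
proof -
  let ?T = "generate G ({cmt G a c, cmt G b c} \<union> \<gamma> 4)"
  have s: "\<gamma> (Suc 2) = \<gamma> 3" "\<gamma> (Suc 3) = \<gamma> 4" by simp_all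
  have m: "cmt G a c \<in> \<gamma> 3" "cmt G b c \<in> \<gamma> 3" using cmt_lc(2)[OF _ c(1)] ab s by simp_all
  have cc: "c \<in> carrier G" using c lc_closed by blast
  have sub: "{cmt G a c, cmt G b c} \<union> \<gamma> 4 \<subseteq> \<gamma> 3" using m lc_antimono[of 3 4] by auto
  have T: "subgroup ?T G" using generate_is_subgroup sub lc_subset by blast
  have N: "?T \<lhd> G"
    by (rule sandwich_normal[of 3, OF _ T])
      (use s generate_subgroup_incl[OF sub lc_subgroup] in \<open>auto intro: generate.incl\<close>)
  have "cmt G a c \<in> ?T" "cmt G b c \<in> ?T" by (auto intro: generate.incl)
  hence "cmt G c a \<in> ?T" "cmt G c b \<in> ?T" using cmt_mem_swap[OF T] ab cc by auto
  hence "\<gamma> (Suc 2) \<subseteq> ?T"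
    by (intro lc_Suc_generate[OF _ c ab N]) (use s in \<open>auto intro: generate.incl\<close>)
  thus ?thesis using s by simp
qed

text \<open>
  Bracketing with \<open>c\<close> is a homomorphism from \<open>G\<close> to the factor \<open>\<gamma> 3 / \<gamma> 4\<close>, which is central.
\<close>
lemma cmt_mult_mod_lc_4:
  assumes c: "c \<in> \<gamma> 2" and q: "quotient_map G Q q (\<gamma> 4)" and xy: "x \<in> carrier G" "y \<in> carrier G"
  shows "q (cmt G (x \<otimes> y) c) = q (cmt G y c) \<otimes>\<^bsub>Q\<^esub> q (cmt G x c)"
proof -
  interpret q: quotient_map G Q q "\<gamma> 4" by fact
  have s: "\<gamma> (Suc 2) = \<gamma> 3" "\<gamma> (Suc 3) = \<gamma> 4" by simp_all
  have cc: "c \<in> carrier G" using c lc_closed by blast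
  have d: "cmt G y c \<in> \<gamma> 3" "cmt G y c \<in> carrier G" using cmt_lc(2)[OF _ c xy(2)] s xy cc by simp_all
  have "cmt G x (cmt G y c) \<in> \<gamma> 4" using cmt_lc(2)[OF _ d(1) xy(1)] s by simp
  hence "q x \<otimes>\<^bsub>Q\<^esub> q (cmt G y c) = q (cmt G y c) \<otimes>\<^bsub>Q\<^esub> q x" using q.commute_iff xy d by simp
  hence "q x \<otimes>\<^bsub>Q\<^esub> q (cmt G y c) \<otimes>\<^bsub>Q\<^esub> inv\<^bsub>Q\<^esub> (q x) = q (cmt G y c)"
    using xy d by (simp add: q.H.m_assoc)
  thus ?thesis using cmt_mult_left[OF xy cc] xy cc d by simp
qed

text \<open>
  The image of the homomorphism \<open>y \<mapsto> [y,c]\<close> contains generators of \<open>\<gamma> 3\<close> modulo \<open>\<gamma> 4\<close>.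
\<close>
lemma lc_3_is_commutator:
  assumes c: "c \<in> \<gamma> 2" "\<gamma> 2 \<subseteq> generate G (insert c (\<gamma> (Suc 2)))" and u: "u \<in> \<gamma> 3"
  shows "\<exists>y\<in>carrier G. u \<otimes> inv (cmt G y c) \<in> \<gamma> 4"
proof -
  obtain Q :: "'a set monoid" and q where q: "quotient_map G Q q (\<gamma> 4)"
    using quotient_map_exists[OF lc_normal] by blast
  then interpret q: quotient_map G Q q "\<gamma> 4" .
  note hom = cmt_mult_mod_lc_4[OF c(1) q]
  have cc: "c \<in> carrier G" using c lc_closed by blast
  obtain a b where ab: "a \<in> carrier G" "b \<in> carrier G" "generate G {a, b} = carrier G"
    using exists_generating_pair by metis
  have one: "cmt G \<one> c = \<one>" using cmt_eq_one_iff cc by simp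
  let ?T = "{u \<in> carrier G. \<exists>y\<in>carrier G. q u = q (cmt G y c)}"
  have T: "subgroup ?T G"
  proof (rule subgroupI)
    show "?T \<noteq> {}" using one by (auto intro!: exI[of _ \<one>] bexI[of _ \<one>])
    fix u assume u: "u \<in> ?T"
    then obtain y where y: "y \<in> carrier G" "q u = q (cmt G y c)" by blast
    have "q (cmt G (inv y \<otimes> y) c) = q (cmt G y c) \<otimes>\<^bsub>Q\<^esub> q (cmt G (inv y) c)"
      using hom[of "inv y" y] y by simp
    hence "q (cmt G y c) \<otimes>\<^bsub>Q\<^esub> q (cmt G (inv y) c) = \<one>\<^bsub>Q\<^esub>" using y one by simp
    hence "inv\<^bsub>Q\<^esub> (q (cmt G y c)) = q (cmt G (inv y) c)"
      using y cc q.H.inv_equality q.H.inv_comm by (metis cmt_closed inv_closed q.hom_closed)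
    thus "inv u \<in> ?T" using u y by auto
    fix v assume v: "v \<in> ?T"
    then obtain z where z: "z \<in> carrier G" "q v = q (cmt G z c)" by blast
    have "q (u \<otimes> v) = q (cmt G (z \<otimes> y) c)" using hom[OF z(1) y(1)] u v y z by simp
    thus "u \<otimes> v \<in> ?T" using u v y z by (auto intro!: bexI[of _ "z \<otimes> y"])
  qed auto
  have "{cmt G a c, cmt G b c} \<union> \<gamma> 4 \<subseteq> ?T"
  proof -
    have "x \<in> ?T" if "x \<in> \<gamma> 4" for x
    proof -
      have "q x = q (cmt G \<one> c)" using that q.trivial_iff[of x] lc_closed[OF that] one by simp
      thus ?thesis using lc_closed[OF that] by blast
    qed
    thus ?thesis using ab cc by auto
  qed
  hence "generate G ({cmt G a c, cmt G b c} \<union> \<gamma> 4) \<subseteq> ?T" by (rule generate_subgroup_incl[OF _ T])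
  hence "u \<in> ?T" using lc_3_generate[OF c ab] u by blast
  thus ?thesis using q.eq_iff cc by auto
qed

text \<open>
  Let \<open>c\<close> generate \<open>\<gamma> 2\<close> modulo \<open>\<gamma> 3\<close>. If \<open>G\<close> is generated by \<open>p\<close> and \<open>r\<close>, then \<open>\<gamma> 4\<close> is generated
  modulo \<open>\<gamma> 5\<close> by the four elements \<open>[t,[s,c]]\<close> with \<open>s\<close> and \<open>t\<close> among \<open>p\<close>, \<open>r\<close>; two of them agree
  by the Jacobi identity. The derived subgroup of \<open>maxsub h\<close> contains \<open>[h,c]\<close> and its commutators.
  That this suffices for some \<open>h\<close> is forced by the cubes: as \<open>\<gamma> 3\<close> is generated by cubes, some \<open>x^3\<close>
  is not in \<open>\<gamma> 4\<close>; writing \<open>x^3 = [y,c]\<close> modulo \<open>\<gamma> 4\<close>, the fact that \<open>x\<close> commutes with \<open>x^3\<close> makes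
  \<open>[x,[y,c]]\<close> trivial modulo \<open>\<gamma> 5\<close>.
\<close>
lemma exists_maxsub_large_derived:
  "\<exists>h\<in>carrier G. h \<notin> \<gamma> 2 \<and> \<gamma> 4 \<subseteq> derived G (maxsub h)"
proof -
  have s: "\<gamma> (Suc 2) = \<gamma> 3" "\<gamma> (Suc 3) = \<gamma> 4" "\<gamma> (Suc 4) = \<gamma> 5" "\<gamma> (Suc (Suc 3)) = \<gamma> 5" by simp_all
  obtain k where nil: "\<gamma> k = {\<one>}" using nilpotent by blast
  obtain a b where ab: "a \<in> carrier G" "b \<in> carrier G" "generate G {a, b} = carrier G"
    using exists_generating_pair by metis
  define c where "c = cmt G a b"
  note c = lc_2_generator[OF ab, folded c_def]
  have cc: "c \<in> carrier G" using c lc_closed by blast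
  have "\<exists>x\<in>carrier G. x [^] (3::nat) \<notin> \<gamma> 4"
  proof (rule ccontr)
    assume "\<not> ?thesis"
    hence "power_subgroup G 3 \<subseteq> \<gamma> 4"
      unfolding power_subgroup_def by (intro generate_subgroup_incl[OF _ lc_subgroup]) auto
    thus False using lc_3_subset_cubes lc_3_not_subset by blast
  qed
  then obtain x where x: "x \<in> carrier G" "x [^] (3::nat) \<notin> \<gamma> 4" by blast
  have x2: "x \<notin> \<gamma> 2" using cube_of_lc_2 x by blast
  obtain y where y: "y \<in> carrier G" "x [^] (3::nat) \<otimes> inv (cmt G y c) \<in> \<gamma> 4"
    using lc_3_is_commutator[OF c cube_in_lc_3[OF x(1)]] by blast
  have xyc: "cmt G x (cmt G y c) \<in> \<gamma> 5"
  proof -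
    let ?C = "{g \<in> carrier G. cmt G x g \<in> \<gamma> 5}"
    have C: "subgroup ?C G" by (rule centralizer_mod_subgroup[OF lc_normal x(1)])
    have "x \<otimes> x [^] (3::nat) = x [^] (3::nat) \<otimes> x" using x by (simp add: cube_eq m_assoc)
    hence "cmt G x (x [^] (3::nat)) = \<one>" using cmt_eq_one_iff[OF x(1), of "x [^] (3::nat)"] x(1) by simp
    hence 1: "x [^] (3::nat) \<in> ?C" using x subgroup.one_closed[OF lc_subgroup] by simp
    have 2: "x [^] (3::nat) \<otimes> inv (cmt G y c) \<in> ?C"
      using cmt_lc(2)[of 4, OF _ y(2) x(1)] s lc_closed[OF y(2)] by simp
    have "inv (cmt G y c) \<in> ?C" by (rule mem_subgroup_right[OF C _ 2 1]) (use y cc in simp)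
    hence "inv (inv (cmt G y c)) \<in> ?C" by (rule subgroup.m_inv_closed[OF C])
    thus ?thesis using y cc by simp
  qed
  have yxc: "cmt G y (cmt G x c) \<in> \<gamma> 5"
    using cmt_swap_mod[OF lc_normal subset_refl x(1) y(1) c(1)] xyc by simp
  \<comment> \<open>Working modulo the derived subgroup times \<gamma> 5 is enough, by lc_subset_of_supplement.\<close>
  have finish: "\<gamma> 4 \<subseteq> derived G (maxsub h)"
    if h: "h \<in> carrier G" and g: "p \<in> carrier G" "r \<in> carrier G" "generate G {p, r} = carrier G"
      and hyp: "\<And>N. N \<lhd> G \<Longrightarrow> \<gamma> 5 \<subseteq> N \<Longrightarrow> cmt G h c \<in> N \<Longrightarrow>
        (\<forall>s\<in>{p, r}. \<forall>t\<in>{p, r}. cmt G t (cmt G s c) \<in> N)" for h p r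
  proof -
    have M: "derived G (maxsub h) \<lhd> G" by (rule derived_is_normal[OF maxsub_normal[OF h]])
    let ?N = "generate G (derived G (maxsub h) \<union> \<gamma> 5)"
    have N: "?N \<lhd> G" by (rule join_normal[OF M lc_normal])
    have sub: "\<gamma> 5 \<subseteq> ?N" by (auto intro: generate.incl)
    have "cmt G h c \<in> derived G (maxsub h)"
      by (rule cmt_in_derived[OF lc_2_maxsub(2) subsetD[OF lc_2_maxsub(1) c(1)]])
    hence "cmt G h c \<in> ?N" by (auto intro: generate.incl)
    note H = hyp[OF N sub this]
    let ?S = "{cmt G p c, cmt G r c} \<union> \<gamma> 4"
    have Sc: "?S \<subseteq> carrier G" using g cc lc_subset by auto
    have "\<gamma> (Suc 3) \<subseteq> ?N"
    proof (rule lc_Suc_generate_least[OF _ N Sc _ lc_3_generate[OF c g] g(3)])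
      fix u t assume u: "u \<in> ?S" and t: "t \<in> {p, r}"
      have tc: "t \<in> carrier G" using t g by auto
      show "cmt G u t \<in> ?N"
      proof (cases "u \<in> \<gamma> 4")
        case True thus ?thesis using cmt_lc(1)[of 4 u t] tc s sub by auto
      next
        case False
        hence "u \<in> {cmt G p c, cmt G r c}" using u by blast
        hence "cmt G t u \<in> ?N" using H t by blast
        thus ?thesis using cmt_mem_swap[OF normal_imp_subgroup[OF N] tc] u Sc by blast
      qed
    qed (use g in auto)
    hence "\<gamma> 4 \<subseteq> ?N" using s by simp
    thus ?thesis using lc_subset_of_supplement[OF nil, of 4, OF _ M] s by simp
  qed
  show ?thesis
  proof (cases "y \<in> maxsub x")
    case False
    \<comment> \<open>Now x and y generate G and both mixed commutators vanish. Modulo N the elements [x,c] and [y,c]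
      are inverse to each other, so x commutes with [x,c] and y with [y,c].\<close>
    let ?h = "x \<otimes> y"
    have h: "?h \<in> carrier G" using x y by simp
    have gen: "generate G {x, y} = carrier G" by (rule generate_pair[OF x(1) x2 y(1) False])
    have "?h \<notin> \<gamma> 2"
    proof
      assume "?h \<in> \<gamma> 2"
      hence "?h \<in> maxsub x" using lc_2_maxsub by blast
      thus False using mem_subgroup_right[OF maxsub_subgroup[OF x(1)] y(1)] lc_2_maxsub(2)[of x] False by blast
    qed
    moreover have "\<gamma> 4 \<subseteq> derived G (maxsub ?h)"
    proof (rule finish[OF h x(1) y(1) gen])
      fix N assume N: "N \<lhd> G" "\<gamma> 5 \<subseteq> N" and hc: "cmt G ?h c \<in> N"
      have xy: "cmt G x (cmt G y c) \<in> N" "cmt G y (cmt G x c) \<in> N" using xyc yxc N by auto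
      have yc: "cmt G y c \<in> carrier G" and xc: "cmt G x c \<in> carrier G" using x y cc by auto
      have "cmt G ?h c = cmt G x (cmt G y c) \<otimes> (cmt G y c \<otimes> cmt G x c)"
        using cmt_mult_left[OF x(1) y(1) cc] conj_eq_cmt[OF x(1) yc] x y cc by (simp add: m_assoc)
      hence "cmt G x (cmt G y c) \<otimes> (cmt G y c \<otimes> cmt G x c) \<in> N" using hc by simp
      hence prod: "cmt G y c \<otimes> cmt G x c \<in> N"
        by (rule mem_subgroup_right[OF normal_imp_subgroup[OF N(1)], rotated]) (use xy xc yc in auto)
      have C: "subgroup {g \<in> carrier G. cmt G t g \<in> N} G" if "t \<in> carrier G" for t
        by (rule centralizer_mod_subgroup[OF N(1) that])
      have prodC: "cmt G y c \<otimes> cmt G x c \<in> {g \<in> carrier G. cmt G t g \<in> N}" if "t \<in> carrier G" for t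
        using cmt_mem_normal(2)[OF N(1) prod that] xc yc by simp
      have "cmt G x c \<in> {g \<in> carrier G. cmt G x g \<in> N}"
        by (rule mem_subgroup_right[OF C[OF x(1)] xc prodC[OF x(1)]]) (use xy yc in simp)
      moreover have "cmt G y c \<in> {g \<in> carrier G. cmt G y g \<in> N}"
        by (rule mem_subgroup_left[OF C[OF y(1)] yc prodC[OF y(1)]]) (use xy xc in simp)
      ultimately show "\<forall>s\<in>{x, y}. \<forall>t\<in>{x, y}. cmt G t (cmt G s c) \<in> N" using xy by auto
    qed
    ultimately show ?thesis using h by blast
  next
    case True
    obtain z where z: "z \<in> carrier G" "z \<notin> maxsub x" using exists_not_in_maxsub[OF x(1)] by blast
    have gen: "generate G {x, z} = carrier G" by (rule generate_pair[OF x(1) x2 z])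
    have z2: "z \<notin> \<gamma> 2" using z lc_2_maxsub by blast
    have xc: "cmt G x c \<in> carrier G" using x cc by simp
    have xc3: "cmt G x c \<in> \<gamma> 3" using cmt_lc(2)[OF _ c(1) x(1)] s by simp
    \<comment> \<open>Here y is congruent to a power of x, which is not trivial since x^3 is not in \<gamma> 4; so x itself
      commutes with [x,c] modulo \<gamma> 5, and any z outside maxsub x can serve as h.\<close>
    have xxc: "cmt G x (cmt G x c) \<in> \<gamma> 5"
    proof -
      let ?C = "{g \<in> carrier G. cmt G (cmt G x c) g \<in> \<gamma> 5}"
      have C: "subgroup ?C G" by (rule centralizer_mod_subgroup[OF lc_normal xc])
      have y2: "\<gamma> 2 \<subseteq> ?C" using cmt_lc_derived(1)[OF _ xc3] s lc_subset by auto
      have yC: "y \<in> ?C" using cmt_mem_swap[OF lc_subgroup y(1) xc yxc] y by simp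
      obtain l :: int where l: "y \<otimes> x [^] l \<in> \<gamma> 2"
        using generate_insert_normal[OF lc_normal x(1) True] by blast
      have xl: "x [^] l \<in> carrier G" using x by simp
      have "\<not> 3 dvd l"
      proof
        assume "3 dvd l"
        then obtain m where m: "l = 3 * m" by blast
        have "x [^] l = (x [^] (3::int)) [^] m" using x m by (simp add: int_pow_pow)
        also have "x [^] (3::int) = x [^] (3::nat)" using int_pow_int[of G x 3] by simp
        finally have "x [^] l \<in> \<gamma> 2"
          using subgroup_int_pow_closed[OF lc_subgroup cube_in_lc_2[OF x(1)], of m] by simp
        hence "y \<in> \<gamma> 2" using mem_subgroup_left[OF lc_subgroup y(1) l] by simp
        hence "cmt G y c \<in> \<gamma> 4" using cmt_lc_2_lc_2[of y c] c(1) lc_antimono[of 4 5] by auto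
        hence "inv (cmt G y c) \<in> \<gamma> 4" by (rule subgroup.m_inv_closed[OF lc_subgroup])
        hence "x [^] (3::nat) \<in> \<gamma> 4" by (rule mem_subgroup_left[OF lc_subgroup _ y(2), rotated]) (use x in simp)
        thus False using x(2) by blast
      qed
      moreover have "x [^] l \<in> ?C" by (rule mem_subgroup_right[OF C xl _ yC]) (use l y2 in blast)
      ultimately have "x \<in> ?C" using coprime_power_mem[OF C x(1), of l] by simp
      thus ?thesis using cmt_mem_swap[OF lc_subgroup xc x(1)] by simp
    qed
    have "\<gamma> 4 \<subseteq> derived G (maxsub z)"
    proof (rule finish[OF z(1) x(1) z(1) gen])
      fix N assume N: "N \<lhd> G" "\<gamma> 5 \<subseteq> N" and zc: "cmt G z c \<in> N"
      have "cmt G x (cmt G z c) \<in> N" "cmt G z (cmt G z c) \<in> N"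
        using cmt_mem_normal(2)[OF N(1) zc] x z by auto
      moreover have "cmt G z (cmt G x c) \<in> N"
        using cmt_swap_mod[OF N x(1) z(1) c(1)] calculation by simp
      ultimately show "\<forall>s\<in>{x, z}. \<forall>t\<in>{x, z}. cmt G t (cmt G s c) \<in> N" using xxc N by auto
    qed
    thus ?thesis using z z2 by blast
  qed
qed

text \<open>
  For the maximal subgroup \<open>H\<close> whose derived subgroup \<open>D\<close> contains \<open>\<gamma> 4\<close>, the group \<open>\<gamma> 3\<close> is generated
  modulo \<open>D\<close> by \<open>[h,c]\<close>, which lies in \<open>D\<close>, and by one further element, whose cube lies in \<open>\<gamma> 4\<close>. So
  \<open>|\<gamma> 3| \<le> 3 |D|\<close>, and \<open>\<gamma> 3\<close> has index 9 in \<open>H\<close>.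
\<close>
lemma exists_maxsub_small_abelianization:
  "\<exists>H. maximal_subgroup H G \<and> subgroup_index (G\<lparr>carrier := H\<rparr>) (derived G H) \<le> 27"
proof -
  have s: "\<gamma> (Suc 2) = \<gamma> 3" "\<gamma> (Suc 3) = \<gamma> 4" by simp_all
  obtain h where h: "h \<in> carrier G" "h \<notin> \<gamma> 2" "\<gamma> 4 \<subseteq> derived G (maxsub h)"
    using exists_maxsub_large_derived by blast
  let ?H = "maxsub h" let ?D = "derived G ?H"
  obtain g where g: "g \<in> carrier G" "g \<notin> ?H" using exists_not_in_maxsub[OF h(1)] by blast
  have gen: "generate G {h, g} = carrier G" by (rule generate_pair[OF h(1,2) g])
  define c where "c = cmt G h g"
  note c = lc_2_generator[OF h(1) g(1) gen, folded c_def]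
  have H: "subgroup ?H G" by (rule maxsub_subgroup[OF h(1)])
  have D: "?D \<lhd> G" by (rule derived_is_normal[OF maxsub_normal[OF h(1)]])
  define t where "t = cmt G g c"
  have t: "t \<in> \<gamma> 3" using cmt_lc(2)[OF _ c(1) g(1)] s t_def by simp
  have tc: "t \<in> carrier G" using t lc_closed by blast
  have A: "subgroup (generate G (insert t ?D)) G" by (rule generate_insert_subgroup[OF normal_imp_subgroup[OF D] tc])
  have "\<gamma> 3 \<subseteq> generate G ({cmt G h c, cmt G g c} \<union> \<gamma> 4)" by (rule lc_3_generate[OF c h(1) g(1) gen])
  also have "\<dots> \<subseteq> generate G (insert t ?D)"
  proof (rule generate_subgroup_incl[OF _ A])
    have "cmt G h c \<in> ?D"
      by (rule cmt_in_derived[OF lc_2_maxsub(2) subsetD[OF lc_2_maxsub(1) c(1)]])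
    thus "{cmt G h c, cmt G g c} \<union> \<gamma> 4 \<subseteq> generate G (insert t ?D)"
      using h(3) t_def by (auto intro: generate.incl)
  qed
  finally have "card (\<gamma> 3) \<le> card (generate G (insert t ?D))"
    using card_mono[OF finite_subgroup[OF A]] by blast
  also have "\<dots> \<le> 3 * card ?D"
  proof (rule card_generate_insert[OF finite_subgroup[OF normal_imp_subgroup[OF D]] D tc])
    show "t [^] (3::nat) \<in> ?D" using cube_of_lc[OF _ t] s h(3) by auto
  qed simp
  finally have "card ?H \<le> 27 * card ?D" using card_maximal[OF h(1,2)] card_lc_2 by simp
  moreover have "subgroup_index (G\<lparr>carrier := ?H\<rparr>) ?D * card ?D = card ?H"
  proof -
    have "subgroup ?D (G\<lparr>carrier := ?H\<rparr>)"
      using normal_imp_subgroup derived_subgroup_is_normal[OF H] by blast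
    thus ?thesis
      unfolding subgroup_index_def using group.lagrange[OF subgroup_imp_group[OF H]] by (simp add: order_def)
  qed
  moreover have "card ?D > 0"
    using finite_subgroup[OF normal_imp_subgroup[OF D]] subgroup.one_closed[OF normal_imp_subgroup[OF D]] by (auto simp: card_gt_0_iff)
  ultimately have "subgroup_index (G\<lparr>carrier := ?H\<rparr>) ?D \<le> 27"
    by (metis mult_le_cancel2 less_le_not_le)
  thus ?thesis using maxsub_maximal[OF h(1,2)] by blast
qed

end

section \<open>Maximal class\<close>

context three_group_index_nine
begin

text \<open>
  The homomorphism \<open>y \<mapsto> [y,c]\<close> maps \<open>G / \<gamma> 2\<close>, of order 9, to \<open>\<gamma> 3 / \<gamma> 4\<close>, of order 3, so its kernel
  is nontrivial. For a generating pair \<open>a\<close>, \<open>b\<close> with \<open>a\<close> outside the kernel, a product \<open>a^j b\<close> with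
  \<open>j < 3\<close> is in the kernel.
\<close>
lemma exists_two_step_centralizer:
  assumes i4: "card (\<gamma> 3) = 3 * card (\<gamma> 4)"
    and c: "c \<in> \<gamma> 2" "\<gamma> 2 \<subseteq> generate G (insert c (\<gamma> (Suc 2)))"
  shows "\<exists>b\<in>carrier G. b \<notin> \<gamma> 2 \<and> cmt G b c \<in> \<gamma> 4"
proof (rule ccontr)
  assume neg: "\<not> ?thesis"
  have s: "\<gamma> (Suc 2) = \<gamma> 3" "\<gamma> (Suc 3) = \<gamma> 4" by simp_all
  have cc: "c \<in> carrier G" using c lc_closed by blast
  obtain a b where ab: "a \<in> carrier G" "b \<in> carrier G" "a \<notin> \<gamma> 2" "b \<notin> maxsub a"
    using exists_generating_pair by metis
  obtain Q :: "'a set monoid" and q where q: "quotient_map G Q q (\<gamma> 4)"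
    using quotient_map_exists[OF lc_normal] by blast
  then interpret q: quotient_map G Q q "\<gamma> 4" .
  note hom = cmt_mult_mod_lc_4[OF c(1) q]
  define d where "d = cmt G a c"
  define e where "e = cmt G b c"
  have d: "d \<in> \<gamma> 3" "e \<in> \<gamma> 3" unfolding d_def e_def using cmt_lc(2)[OF _ c(1)] ab s by simp_all
  have dc: "d \<in> carrier G" "e \<in> carrier G" using d lc_closed by blast+
  have dn: "d \<notin> \<gamma> 4" using neg ab d_def by blast
  have gen: "generate G (insert d (\<gamma> 4)) = \<gamma> 3"
  proof -
    have A: "subgroup (generate G (insert d (\<gamma> 4))) G" by (rule generate_insert_subgroup[OF lc_subgroup dc(1)])
    have "3 * card (\<gamma> 4) \<le> card (generate G (insert d (\<gamma> 4)))"
      using card_psubset_subgroup[OF lc_subgroup A psubset_generate_insert[OF lc_subgroup dc(1) dn]] .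
    moreover have "generate G (insert d (\<gamma> 4)) \<subseteq> \<gamma> 3"
      by (rule generate_subgroup_incl[OF _ lc_subgroup]) (use d lc_antimono[of 3 4] in simp)
    ultimately show ?thesis using card_seteq[OF finite_subgroup[OF lc_subgroup]] i4 by simp
  qed
  have "e \<in> generate G (insert d (\<gamma> 4))" using gen d by simp
  then obtain k :: int where k: "e \<otimes> d [^] k \<in> \<gamma> 4"
    using generate_insert_normal[OF lc_normal dc(1)] by blast
  \<comment> \<open>A nonnegative exponent allows the induction on i below.\<close>
  define j where "j = nat (k mod 3)"
  have j: "j \<in> {0, 1, 2}" using j_def by auto
  have "k = int j + 3 * (k div 3)" using j_def by simp
  hence "d [^] k = d [^] (int j + 3 * (k div 3))" by simp
  also have "\<dots> = d [^] int j \<otimes> (d [^] (3::int)) [^] (k div 3)"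
    using dc by (simp add: int_pow_mult int_pow_pow)
  finally have kj: "d [^] k = d [^] j \<otimes> (d [^] (3::nat)) [^] (k div 3)"
    using int_pow_int[of G d j] int_pow_int[of G d 3] by simp
  have d3: "(d [^] (3::nat)) [^] (k div 3) \<in> \<gamma> 4"
    by (rule subgroup_int_pow_closed[OF lc_subgroup]) (use cube_of_lc[OF _ d(1)] s in simp)
  have "(e \<otimes> d [^] j) \<otimes> (d [^] (3::nat)) [^] (k div 3) \<in> \<gamma> 4" using k kj dc by (simp add: m_assoc)
  hence ej: "e \<otimes> d [^] j \<in> \<gamma> 4"
    by (rule mem_subgroup_left[OF lc_subgroup, rotated]) (use dc d3 in simp_all)
  have "q (cmt G (a [^] i \<otimes> b) c) = q (e \<otimes> d [^] i)" for i :: nat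
  proof (induction i)
    case 0 thus ?case using ab dc e_def by simp
  next
    case (Suc i)
    have "a [^] Suc i \<otimes> b = a \<otimes> (a [^] i \<otimes> b)" using ab nat_pow_Suc2 by (simp add: m_assoc del: nat_pow_Suc)
    hence "q (cmt G (a [^] Suc i \<otimes> b) c) = q (cmt G (a [^] i \<otimes> b) c) \<otimes>\<^bsub>Q\<^esub> q d"
      using hom[of a "a [^] i \<otimes> b"] ab d_def by simp
    thus ?case using Suc dc by (simp add: q.H.m_assoc)
  qed
  hence "cmt G (a [^] j \<otimes> b) c \<in> \<gamma> 4"
    using ej q.trivial_iff[of "cmt G (a [^] j \<otimes> b) c"] q.trivial_iff[of "e \<otimes> d [^] j"] ab cc dc by simp
  moreover have "a [^] j \<otimes> b \<notin> \<gamma> 2"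
  proof
    assume "a [^] j \<otimes> b \<in> \<gamma> 2"
    hence 1: "a [^] j \<otimes> b \<in> maxsub a" using lc_2_maxsub by blast
    have "a [^] int j \<in> maxsub a" by (rule subgroup_int_pow_closed[OF maxsub_subgroup[OF ab(1)] lc_2_maxsub(2)])
    hence "a [^] j \<in> maxsub a" using int_pow_int[of G a j] by simp
    hence "b \<in> maxsub a" by (rule mem_subgroup_right[OF maxsub_subgroup[OF ab(1)] ab(2) 1])
    thus False using ab by blast
  qed
  ultimately show False using neg ab by blast
qed

text \<open>
  Choose \<open>b\<close> outside \<open>\<gamma> 2\<close> that centralizes \<open>\<gamma> 2\<close> modulo \<open>\<gamma> 4\<close>, a second generator \<open>a\<close>, and let \<open>t 0 = [b,a]\<close>
  and \<open>t (j + 1) = [a, t j]\<close>. Then \<open>\<gamma> (j + 3)\<close> is generated modulo the next term by \<open>t (j + 1)\<close>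
  and \<open>[b, t j]\<close>, and the point is that the latter lies one term deeper.

  For \<open>j \<ge> 2\<close> this rests on cubes. The cube formula for \<open>[b,a^3]\<close> shows that \<open>t 2\<close> is the inverse
  of the cube of \<open>t 0\<close> modulo \<open>\<gamma> 5\<close>, and commutation with \<open>a\<close> carries this relation along:
  \<open>t (j + 2)\<close> is the inverse of the cube of \<open>t j\<close> modulo \<open>\<gamma> (j + 5)\<close>. Consequently \<open>[b, t (j + 2)]\<close> is the
  inverse of the cube of \<open>[b, t j]\<close> modulo \<open>\<gamma> (j + 6)\<close>; the element \<open>[b, t j]\<close> lies in \<open>\<gamma> (j + 4)\<close>, and by
  the same relations cubing moves elements of \<open>\<gamma> (j + 4)\<close> down by two terms.
\<close>
lemma lc_uniserial:
  assumes i4: "card (\<gamma> 3) = 3 * card (\<gamma> 4)" and i: "2 \<le> i" and nt: "\<gamma> i \<noteq> {\<one>}"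
  shows "card (\<gamma> i) = 3 * card (\<gamma> (Suc i))"
proof (cases "\<gamma> 4 = {\<one>}")
  case True
  have "i < 4"
  proof (rule ccontr)
    assume "\<not> i < 4"
    hence "\<gamma> i \<subseteq> {\<one>}" using lc_antimono[of 4 i] True by simp
    thus False using nt subgroup.one_closed[OF lc_subgroup] by blast
  qed
  hence "i = 2 \<or> i = 3" using i by linarith
  thus ?thesis using card_lc_2 i4 by auto
next
  case nt4: False
  have s: "\<gamma> (Suc 2) = \<gamma> 3" "\<gamma> (Suc 3) = \<gamma> 4" "\<gamma> (Suc 4) = \<gamma> 5" "\<gamma> (Suc (Suc 0)) = \<gamma> 2"
    "\<gamma> (Suc (Suc (Suc 0))) = \<gamma> 3" "\<gamma> (Suc (Suc 2)) = \<gamma> 4"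
    by (simp_all add: eval_nat_numeral)
  obtain a0 b0 where ab0: "a0 \<in> carrier G" "b0 \<in> carrier G" "generate G {a0, b0} = carrier G"
    using exists_generating_pair by metis
  define c where "c = cmt G a0 b0"
  note c = lc_2_generator[OF ab0, folded c_def]
  have cc: "c \<in> carrier G" using c lc_closed by blast
  obtain b where b: "b \<in> carrier G" "b \<notin> \<gamma> 2" "cmt G b c \<in> \<gamma> 4"
    using exists_two_step_centralizer[OF i4 c] by blast
  obtain a where a: "a \<in> carrier G" "a \<notin> maxsub b" using exists_not_in_maxsub[OF b(1)] by blast
  have gen: "generate G {b, a} = carrier G" by (rule generate_pair[OF b(1,2) a])
  define t where "t j = ((\<lambda>u. cmt G a u) ^^ j) (cmt G b a)" for j
  have t0: "t 0 = cmt G b a" and tS: "\<And>j. t (Suc j) = cmt G a (t j)" by (simp_all add: t_def)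
  have tm: "t j \<in> \<gamma> (j + 2)" for j
  proof (induction j)
    case 0 show ?case using lc_2_generator(1)[OF b(1) a(1) gen] t0 s by simp
  next
    case (Suc j)
    show ?case using cmt_lc(2)[OF _ Suc a(1)] tS by simp
  qed
  have tm': "t j \<in> \<gamma> (Suc (Suc j))" for j using tm[of j] by simp
  have tc: "t j \<in> carrier G" for j using tm lc_closed by blast
  \<comment> \<open>The index j of t, Gen, R and P counts from 0 for the term \<gamma> 2.\<close>
  define Gen where "Gen j \<longleftrightarrow> \<gamma> (Suc (Suc j)) \<subseteq> generate G (insert (t j) (\<gamma> (Suc (Suc (Suc j)))))" for j
  define R where "R j \<longleftrightarrow> cmt G b (t j) \<in> \<gamma> (j + 4)" for j
  define P where "P j \<longleftrightarrow> t j [^] (3::nat) \<otimes> t (Suc (Suc j)) \<in> \<gamma> (j + 5)" for j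
  have Gen0: "Gen 0"
    using lc_2_generator(2)[OF b(1) a(1) gen] t0 unfolding Gen_def by (simp add: s)
  have GenS: "Gen (Suc j)" if "Gen j" "R j" for j
    unfolding Gen_def
  proof (rule lc_Suc_generate[OF _ tm' _ b(1) a(1) gen])
    show "\<gamma> (Suc (Suc j)) \<subseteq> generate G (insert (t j) (\<gamma> (Suc (Suc (Suc j)))))"
      using that Gen_def by blast
    show N: "generate G (insert (t (Suc j)) (\<gamma> (Suc (Suc (Suc (Suc j)))))) \<lhd> G"
      by (rule generate_insert_lc_normal[OF _ tm']) simp
    show sub: "\<gamma> (Suc (Suc (Suc (Suc j)))) \<subseteq> generate G (insert (t (Suc j)) (\<gamma> (Suc (Suc (Suc (Suc j))))))"
      by (auto intro: generate.incl)
    have "cmt G (t j) b \<in> \<gamma> (j + 4)"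
      by (rule cmt_mem_swap[OF lc_subgroup b(1) tc]) (use that R_def in blast)
    moreover have "\<gamma> (Suc (Suc (Suc (Suc j)))) = \<gamma> (j + 4)" by (simp add: eval_nat_numeral)
    ultimately show "cmt G (t j) b \<in> generate G (insert (t (Suc j)) (\<gamma> (Suc (Suc (Suc (Suc j))))))"
      using sub by blast
    have "cmt G a (t j) \<in> generate G (insert (t (Suc j)) (\<gamma> (Suc (Suc (Suc (Suc j))))))"
      using tS by (auto intro: generate.incl)
    thus "cmt G (t j) a \<in> generate G (insert (t (Suc j)) (\<gamma> (Suc (Suc (Suc (Suc j))))))"
      by (rule cmt_mem_swap[OF normal_imp_subgroup[OF N] a(1) tc])
  qed simp
  have R0: "R 0"
  proof -
    have "cmt G b (t 0) \<in> \<gamma> 4"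
    proof (rule cmt_mem_generate_right[OF lc_normal b(1)])
      show "insert c (\<gamma> (Suc 2)) \<subseteq> carrier G" using cc lc_subset by blast
      show "t 0 \<in> generate G (insert c (\<gamma> (Suc 2)))" using tm'[of 0] c(2) s by auto
      fix u assume "u \<in> insert c (\<gamma> (Suc 2))"
      thus "cmt G b u \<in> \<gamma> 4" using b cmt_lc(2)[of "Suc 2" u b] s by auto
    qed
    thus ?thesis by (simp add: R_def)
  qed
  \<comment> \<open>The Jacobi identity, with [b,a] = t 0 itself as the inner element.\<close>
  have R1: "R 1"
  proof -
    have "cmt G b (t 0) \<in> \<gamma> 4" using R0 by (simp add: R_def)
    hence "cmt G a (cmt G b (t 0)) \<in> \<gamma> 5" using cmt_lc(2)[of 4, OF _ _ a(1)] s by simp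
    hence "cmt G b (cmt G a (t 0)) \<in> \<gamma> 5"
      using cmt_swap_mod[OF lc_normal subset_refl a(1) b(1)] tm'[of 0] s by simp
    thus ?thesis using tS[of 0] by (simp add: R_def)
  qed
  have Gen1: "Gen 1" using GenS[OF Gen0 R0] by simp
  \<comment> \<open>Modulo \<gamma> 4 the cube of a is a power of t 1. As a commutes with its cube but not with t 1 modulo
    \<gamma> 5, this power is trivial. Here \<gamma> 4 \<noteq> {\<one>} enters.\<close>
  have a3: "a [^] (3::nat) \<in> \<gamma> 4"
  proof -
    have g3: "\<gamma> 3 \<subseteq> generate G (insert (t 1) (\<gamma> 4))" using Gen1 by (simp add: Gen_def eval_nat_numeral)
    have t1: "t 1 \<in> \<gamma> 3" using tm[of 1] by (simp add: eval_nat_numeral)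
    obtain k :: int where k: "a [^] (3::nat) \<otimes> t 1 [^] k \<in> \<gamma> 4"
      using generate_insert_normal[OF lc_normal tc] subsetD[OF g3 cube_in_lc_3[OF a(1)]] by blast
    have tk: "t 1 [^] k \<in> carrier G" using tc by simp
    have a3c: "a [^] (3::nat) \<in> carrier G" using a by simp
    let ?C = "{g \<in> carrier G. cmt G a g \<in> \<gamma> 5}"
    have C: "subgroup ?C G" by (rule centralizer_mod_subgroup[OF lc_normal a(1)])
    have "a \<otimes> a [^] (3::nat) = a [^] (3::nat) \<otimes> a" using a by (simp add: cube_eq m_assoc)
    hence "cmt G a (a [^] (3::nat)) = \<one>" using cmt_eq_one_iff[OF a(1) a3c] by simp
    hence 1: "a [^] (3::nat) \<in> ?C" using a3c subgroup.one_closed[OF lc_subgroup] by simp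
    have 2: "a [^] (3::nat) \<otimes> t 1 [^] k \<in> ?C"
      using cmt_lc(2)[of 4, OF _ k a(1)] s lc_closed[OF k] by simp
    have tkC: "t 1 [^] k \<in> ?C" by (rule mem_subgroup_right[OF C tk 2 1])
    have "3 dvd k"
    proof (rule ccontr)
      assume "\<not> 3 dvd k"
      hence "t 1 \<in> ?C" using coprime_power_mem[OF C tc _ tkC] by simp
      hence t2: "t 2 \<in> \<gamma> 5" using tS[of 1] by (simp add: numeral_2_eq_2)
      have "Gen (Suc 1)" by (rule GenS[OF Gen1 R1])
      hence "\<gamma> 4 \<subseteq> generate G (insert (t 2) (\<gamma> 5))" by (simp add: Gen_def eval_nat_numeral)
      also have "\<dots> \<subseteq> \<gamma> 5" by (rule generate_subgroup_incl[OF _ lc_subgroup]) (use t2 in simp)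
      finally show False using lc_strict[of 4] nt4 by auto
    qed
    then obtain m where m: "k = 3 * m" by blast
    have "t 1 [^] k = (t 1 [^] (3::int)) [^] m" using tc m by (simp add: int_pow_pow)
    also have "t 1 [^] (3::int) = t 1 [^] (3::nat)" using int_pow_int[of G "t 1" 3] by simp
    finally have "t 1 [^] k \<in> \<gamma> 4"
      using subgroup_int_pow_closed[OF lc_subgroup, of "t 1 [^] (3::nat)" 4 m] cube_of_lc[OF _ t1] s by simp
    thus ?thesis by (rule mem_subgroup_left[OF lc_subgroup a3c k])
  qed
  \<comment> \<open>The correction term z = t 2 of the cube formula survives modulo \<gamma> 5, whereas [b,a^3] does not.\<close>
  have P0: "P 0"
  proof -
    have t2: "t 0 \<in> \<gamma> 2" "t 1 \<in> \<gamma> 3" "t 2 \<in> \<gamma> 4"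
      using tm[of 0] tm[of 1] tm[of 2] by (simp_all add: eval_nat_numeral)
    have t3c: "t 1 [^] (3::nat) \<in> \<gamma> 5"
    proof -
      have "cmt G a (t 0 [^] (3::nat)) \<in> \<gamma> 5"
        using cmt_lc(2)[of 4, OF _ cube_of_lc_2[OF t2(1)] a(1)] s by simp
      moreover have v: "cmt G (t 0) (cmt G a (t 0)) \<in> \<gamma> 5"
        using cmt_lc_2_lc_2[OF t2(1)] t2(2) tS[of 0] lc_antimono[of 2 3] by auto
      have "cmt G a (t 0 [^] (3::nat)) \<in> \<gamma> 5 \<longleftrightarrow> cmt G a (t 0) [^] (3::nat) \<in> \<gamma> 5"
        by (rule cmt_cube_mod_iff[OF lc_normal a(1) tc refl])
          (use cmt_mem_normal[OF lc_normal v] a tc v cube_of_lc[OF _ v] lc_Suc_subset[of 5] in auto)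
      ultimately show ?thesis using tS[of 0] by simp
    qed
    have e: "cmt G a (t 0) = t 1" "cmt G a (t 1) = t 2" using tS[of 0] tS[of 1] by (simp_all add: numeral_2_eq_2)
    have "cmt G b (a [^] (3::nat)) \<otimes> inv (t 0 [^] (3::nat) \<otimes> t 2) \<in> \<gamma> 5"
    proof (rule cmt_cube_mod[OF lc_normal b(1) a(1) t0 e(1)[symmetric] e(2)[symmetric] _ _ _ t3c])
      have "t 1 \<in> \<gamma> 2" using t2 lc_antimono[of 2 3] by auto
      thus "cmt G (t 1) (t 0) \<in> \<gamma> 5" using cmt_lc_2_lc_2 t2 by blast
      show "cmt G (t 2) (t 0) \<in> \<gamma> 5" "cmt G (t 2) (t 1) \<in> \<gamma> 5"
        using cmt_lc(1)[of 4, OF _ t2(3)] tc s by simp_all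
    qed
    moreover have "cmt G b (a [^] (3::nat)) \<in> \<gamma> 5" using cmt_lc(2)[of 4, OF _ a3 b(1)] s by simp
    ultimately have "inv (t 0 [^] (3::nat) \<otimes> t 2) \<in> \<gamma> 5"
      by (rule mem_subgroup_right[OF lc_subgroup, rotated]) (use tc in simp)
    hence "inv (inv (t 0 [^] (3::nat) \<otimes> t 2)) \<in> \<gamma> 5" by (rule subgroup.m_inv_closed[OF lc_subgroup])
    thus ?thesis unfolding P_def using tc by (simp add: eval_nat_numeral)
  qed
  \<comment> \<open>Commutation with a: modulo \<gamma> (j + 6) it sends the cube of t j to the cube of t (j + 1) and t (j + 2) to t (j + 3).\<close>
  have PS: "P (Suc j)" if Pj: "P j" for j
  proof -
    let ?N = "\<gamma> (j + 6)"
    have sN: "Suc (j + 5) = j + 6" "Suc (Suc (Suc j) + 2) = j + 5" "Suc (Suc (Suc j + 2)) = j + 5" by simp_all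
    have c3: "t j [^] (3::nat) \<in> carrier G" "t (Suc j) [^] (3::nat) \<in> carrier G" using tc by simp_all
    have v: "cmt G (t j) (t (Suc j)) \<in> \<gamma> (j + 5)"
    proof -
      have "t j \<in> \<gamma> 2" using tm[of j] lc_antimono[of 2 "j + 2"] by auto
      thus ?thesis using cmt_lc_derived(2)[OF _ tm[of "Suc j"], of "t j"] by (simp add: eval_nat_numeral)
    qed
    have v': "cmt G (cmt G (t j) (t (Suc j))) u \<in> ?N" "cmt G u (cmt G (t j) (t (Suc j))) \<in> ?N"
      if "u \<in> carrier G" for u using cmt_lc[OF _ v that] sN by simp_all
    have v3: "cmt G (t j) (t (Suc j)) [^] (3::nat) \<in> ?N" using cube_of_lc[OF _ v] sN by simp
    have 1: "cmt G a (t j [^] (3::nat)) \<otimes> inv (t (Suc j) [^] (3::nat) \<otimes> cmt G (t j) (cmt G (t j) (t (Suc j)))) \<in> ?N"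
      by (rule cmt_cube_mod[OF lc_normal a(1) tc tS refl refl])
        (use v' v3 tc cmt_mem_normal(1)[OF lc_normal v'(2)[OF tc[of j]]] in auto)
    have 2: "cmt G a (t j [^] (3::nat) \<otimes> t (Suc (Suc j))) \<in> ?N"
      using cmt_lc(2)[OF _ Pj[unfolded P_def] a(1)] sN by simp
    obtain Q :: "'a set monoid" and q where "quotient_map G Q q ?N"
      using quotient_map_exists[OF lc_normal] by blast
    then interpret q: quotient_map G Q q ?N .
    have t3: "t (Suc (Suc (Suc j))) \<in> \<gamma> (j + 5)" using tm[of "Suc (Suc (Suc j))"] by (simp add: eval_nat_numeral)
    have com: "cmt G (t j [^] (3::nat)) (t (Suc (Suc (Suc j)))) \<in> ?N"
      using cmt_lc(2)[OF _ t3 c3(1)] sN by simp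
    have "q (cmt G a (t j [^] (3::nat))) = q (t (Suc j) [^] (3::nat) \<otimes> cmt G (t j) (cmt G (t j) (t (Suc j))))"
      using q.eq_iff[THEN iffD2, OF _ _ 1] a c3 tc by simp
    also have "\<dots> = q (t (Suc j) [^] (3::nat))"
      using q.trivial_iff[THEN iffD2, OF _ v'(2)[OF tc[of j]]] tc by simp
    finally have e: "q (cmt G a (t j [^] (3::nat))) = q (t (Suc j) [^] (3::nat))" .
    have "\<one>\<^bsub>Q\<^esub> = q (cmt G a (t j [^] (3::nat) \<otimes> t (Suc (Suc j))))"
      using q.trivial_iff[THEN iffD2, OF _ 2] a tc by simp
    also have "\<dots> = q (cmt G a (t j [^] (3::nat))) \<otimes>\<^bsub>Q\<^esub>
        (q (t j [^] (3::nat)) \<otimes>\<^bsub>Q\<^esub> q (t (Suc (Suc (Suc j)))) \<otimes>\<^bsub>Q\<^esub> inv\<^bsub>Q\<^esub> (q (t j [^] (3::nat))))"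
      using cmt_mult_right[OF a(1) c3(1) tc[of "Suc (Suc j)"]] tS[of "Suc (Suc j)"] a c3 tc
      by (simp del: q.hom_nat_pow)
    also have "q (t j [^] (3::nat)) \<otimes>\<^bsub>Q\<^esub> q (t (Suc (Suc (Suc j)))) \<otimes>\<^bsub>Q\<^esub> inv\<^bsub>Q\<^esub> (q (t j [^] (3::nat)))
      = q (t (Suc (Suc (Suc j))))"
    proof -
      have "q (t j [^] (3::nat)) \<otimes>\<^bsub>Q\<^esub> q (t (Suc (Suc (Suc j)))) = q (t (Suc (Suc (Suc j)))) \<otimes>\<^bsub>Q\<^esub> q (t j [^] (3::nat))"
        using q.commute_iff[OF c3(1) tc] com by simp
      thus ?thesis using q.hom_closed[OF c3(1)] q.hom_closed[OF tc] by (simp add: q.H.m_assoc)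
    qed
    finally have "q (t (Suc j) [^] (3::nat) \<otimes> t (Suc (Suc (Suc j)))) = \<one>\<^bsub>Q\<^esub>"
      using e c3 tc by simp
    hence "t (Suc j) [^] (3::nat) \<otimes> t (Suc (Suc (Suc j))) \<in> ?N"
      by (rule q.trivial_iff[THEN iffD1, rotated]) (use tc in simp)
    moreover have "Suc j + 5 = j + 6" by simp
    ultimately show ?thesis unfolding P_def by metis
  qed
  have P: "P j" for j by (induction j) (use P0 PS in auto)
  have cubes: "x [^] (3::nat) \<in> \<gamma> (j + 4)" if "Gen j" "x \<in> \<gamma> (j + 2)" for j x
  proof -
    have "\<gamma> (j + 5) \<subseteq> \<gamma> (j + 4)" by (rule lc_antimono) simp
    hence "t j [^] (3::nat) \<otimes> t (Suc (Suc j)) \<in> \<gamma> (j + 4)" using P[of j] P_def by blast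
    moreover have "t (Suc (Suc j)) \<in> \<gamma> (j + 4)" using tm[of "Suc (Suc j)"] by (simp add: eval_nat_numeral)
    ultimately have "t j [^] (3::nat) \<in> \<gamma> (j + 4)"
      by (rule mem_subgroup_left[OF lc_subgroup, rotated]) (use tc in simp)
    moreover have e: "j + 4 = Suc (Suc (Suc (Suc j)))" by simp
    ultimately have t3: "t j [^] (3::nat) \<in> \<gamma> (Suc (Suc (Suc (Suc j))))" by metis
    have x: "x \<in> \<gamma> (Suc (Suc j))" using that(2) by simp
    show ?thesis unfolding e
      by (rule exponent_two_steps[OF _ tm' that(1)[unfolded Gen_def] t3 x]) simp
  qed
  \<comment> \<open>Modulo \<gamma> (j + 6) the element b commutes with t j ^ 3 and with the product in P j, hence with t (j + 2).\<close>
  have RSS: "R (Suc (Suc j))" if Rj: "R j" and Gj: "Gen (Suc (Suc j))" for j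
  proof -
    let ?N = "\<gamma> (j + 6)"
    define w where "w = cmt G b (t j)"
    have w: "w \<in> \<gamma> (j + 4)" using Rj R_def w_def by simp
    have wc: "w \<in> carrier G" using w lc_closed by blast
    have v: "cmt G (t j) w \<in> ?N"
    proof -
      have "t j \<in> \<gamma> 2" using tm[of j] lc_antimono[of 2 "j + 2"] by auto
      thus ?thesis using cmt_lc_derived(2)[OF _ w, of "t j"] by (simp add: eval_nat_numeral)
    qed
    have v3: "cmt G (t j) w [^] (3::nat) \<in> ?N" using cube_of_lc[OF _ v] lc_Suc_subset[of "j + 6"] by auto
    have w3: "w [^] (3::nat) \<in> ?N" using cubes[OF Gj, of w] w by (simp add: eval_nat_numeral)
    have "cmt G b (t j [^] (3::nat)) \<in> ?N \<longleftrightarrow> cmt G b (t j) [^] (3::nat) \<in> ?N"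
      by (rule cmt_cube_mod_iff[OF lc_normal b(1) tc refl])
        (use v v3 cmt_mem_normal[OF lc_normal v] tc wc w_def in auto)
    hence 1: "cmt G b (t j [^] (3::nat)) \<in> ?N" using w3 w_def by simp
    let ?C = "{g \<in> carrier G. cmt G b g \<in> ?N}"
    have C: "subgroup ?C G" by (rule centralizer_mod_subgroup[OF lc_normal b(1)])
    have s6: "Suc (j + 5) = j + 6" by simp
    have "cmt G b (t j [^] (3::nat) \<otimes> t (Suc (Suc j))) \<in> \<gamma> (j + 6)"
      unfolding s6[symmetric] by (rule cmt_lc(2)[OF _ _ b(1)]) (use P[of j] P_def in auto)
    hence 2: "t j [^] (3::nat) \<otimes> t (Suc (Suc j)) \<in> ?C" using tc by simp
    have "t (Suc (Suc j)) \<in> ?C"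
      by (rule mem_subgroup_right[OF C tc 2]) (use 1 tc in simp)
    moreover have "Suc (Suc j) + 4 = j + 6" by simp
    ultimately show ?thesis unfolding R_def by (metis mem_Collect_eq)
  qed
  have all: "Gen j \<and> R j \<and> Gen (Suc j) \<and> R (Suc j)" for j
  proof (induction j)
    case 0 thus ?case using Gen0 R0 Gen1 R1 by simp
  next
    case (Suc j)
    hence "Gen (Suc (Suc j))" using GenS by blast
    thus ?case using Suc RSS by blast
  qed
  obtain j where j: "i = Suc (Suc j)" using i by (metis add_2_eq_Suc le_Suc_ex)
  show ?thesis unfolding j
    by (rule card_lc_step[OF _ tm']) (use all[of j] nt j in \<open>auto simp: Gen_def\<close>)
qed

text \<open>
  All steps of the lower central series below \<open>\<gamma> 2\<close> have index 3, so a group of class \<open>m\<close> has order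
  \<open>9 * 3 ^ (m - 1)\<close>.
\<close>
lemma maximal_class_of_index:
  assumes i4: "card (\<gamma> 3) = 3 * card (\<gamma> 4)"
  shows "maximal_class G"
proof -
  let ?P = "\<lambda>c. \<gamma> (c + 1) = {\<one>}"
  define m where "m = (LEAST c. ?P c)"
  have nil: "nilpotent_group G" unfolding nilpotent_group_def using lc_eventually_trivial by simp
  hence "\<exists>c. ?P c" unfolding nilpotent_group_def .
  hence Pm: "?P m" unfolding m_def by (rule LeastI_ex)
  have below: "\<gamma> (Suc c) \<noteq> {\<one>}" if "c < m" for c using not_less_Least[of c ?P] that m_def by simp
  have m2: "2 < m"
  proof (rule ccontr)
    assume "\<not> 2 < m"
    hence "\<gamma> 3 \<subseteq> \<gamma> (m + 1)" using lc_antimono[of "m + 1" 3] by simp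
    thus False using Pm lc_3_nontrivial subgroup.one_closed[OF lc_subgroup, of 3] by auto
  qed
  have "card (\<gamma> 2) = 3 ^ j * card (\<gamma> (j + 2))" if "j < m" for j
    using that
  proof (induction j)
    case (Suc j)
    have "\<gamma> (j + 2) \<noteq> {\<one>}" using below[of "Suc j"] Suc by simp
    hence "card (\<gamma> (j + 2)) = 3 * card (\<gamma> (Suc (j + 2)))" by (intro lc_uniserial[OF i4]) auto
    thus ?case using Suc by simp
  qed (simp add: numeral_2_eq_2)
  from this[of "m - 1"] have "card (\<gamma> 2) = 3 ^ (m - 1) * card (\<gamma> (m - 1 + 2))" using m2 by simp
  moreover have "m - 1 + 2 = m + 1" using m2 by simp
  ultimately have "card (\<gamma> 2) = 3 ^ (m - 1)" using Pm by simp
  moreover have "(3::nat) ^ (m + 1) = 9 * 3 ^ (m - 1)" using m2 by (cases m) simp_all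
  ultimately have "order G = 3 ^ (m + 1)" using order_derived by simp
  moreover have "nilpotency_class G = m" unfolding nilpotency_class_def m_def ..
  ultimately show ?thesis
    unfolding maximal_class_def using nil m2 prime_p by (intro exI[of _ 3] exI[of _ "m + 1"]) auto
qed

end

section \<open>Finite 3-groups with abelianization of order 9\<close>

theorem proposition5:
  fixes G :: "('a, 'b) monoid_scheme"
  assumes "group G"
    and "finite (carrier G)"
    and "\<exists>n. order G = 3 ^ n"
    and "subgroup_index G (derived G (carrier G)) = 9"
    and "order G \<ge> 81"
  shows "power_subgroup G 3 = lower_central G 3
    \<and> subgroup_index G (lower_central G 3) = 27
    \<and> (\<forall>H. maximal_subgroup H G \<longrightarrow>
          (\<exists>S \<subseteq> H. finite S \<and> card S \<le> 3 \<and> generate G S = H))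
    \<and> ((\<exists>H. maximal_subgroup H G \<and> metacyclic_group (G\<lparr>carrier := H\<rparr>))
        \<or> (\<exists>H. maximal_subgroup H G
              \<and> subgroup_index (G\<lparr>carrier := H\<rparr>) (derived G H) \<le> 27))
    \<and> (subgroup_index G (lower_central G 4) = 3 ^ 4 \<longrightarrow> maximal_class G)"
proof -
  interpret group G by fact
  have "order G = 9 * card (lower_central G 2)"
    using lagrange[OF lc_subgroup, of 2] assms(4) by (simp add: subgroup_index_def lower_central_2)
  moreover have "Factorial_Ring.prime (3::nat)" by simp
  ultimately interpret three_group_index_nine G
    using assms by unfold_locales auto
  have "maximal_class G" if "subgroup_index G (lower_central G 4) = 3 ^ 4"
  proof (rule maximal_class_of_index)
    have "81 * card (lower_central G 4) = 27 * card (lower_central G 3)"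
      using that lagrange[OF lc_subgroup, of 4] order_derived card_lc_2 by (simp add: subgroup_index_def)
    thus "card (lower_central G 3) = 3 * card (lower_central G 4)" by simp
  qed
  moreover have "\<exists>S\<subseteq>H. finite S \<and> card S \<le> 3 \<and> generate G S = H" if H: "maximal_subgroup H G" for H
    using maximal_subgroup_eq_maxsub[OF H] maxsub_three_generated by metis
  ultimately show ?thesis
    using cubes_eq_lc_3 index_lc_3 exists_maxsub_small_abelianization by blast
qed

end
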